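(* Let $\mathcal{C}$ be a semi-abelian category and let $H \leq K \leq G$ be subobjects in $\mathcal{C}$. If $H$ is a characteristic subobject of $K$, and $K$ is a normal subobject of $G$, then $H$ is normal in $G$.
   Context: A normal subobject is a subobject that is the kernel of some morphism. For an object $B$ of a pointed category $\mathcal{C}$ with finite limits and finite coproducts, let $\mathrm{Pt}_B(\mathcal{C})$ be the category of points over $B$: objects are split epimorphisms $(A,p,s)$ with $p\colon A\to B$, $s\colon B\to A$, $ps=1_B$; morphisms $(A,p,s)\to(A',p',s')$ are arrows $f\colon A\to A'$ with $p'f=p$, $fs=s'$. The functor $\mathrm{Ker}_B\colon \mathrm{Pt}_B(\mathcal{C})\to\mathcal{C}$, $(A,p,s)\mapsto \mathrm{Ker}(p)$, is right adjoint to $B+(-)$, which sends $X$ to the point $(B+X,[1,0],\iota_B)$. The induced monad on $\mathcal{C}$ is denoted $B\flat(-)$, so that $B\flat X$ is the kernel of $[1,0]\colon B+X\to B$. An (internal) action of $B$ on $X$ is an algebra $\xi\colon B\flat X\to X$ for this monad. A subobject $h\colon H\rightarrowtail G$ is called characteristic in $G$ if for every object $B$ and every action $\xi\colon B\flat G\to G$ there exists a (unique) action $\overline{\xi}\colon B\flat H\to H$ with $h\,\overline{\xi}=\xi\,(1_B\flat h)$. *)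

theory Defs
  imports Main
begin

section \<open>Categories\<close>

record ('o, 'a) cat =
  Ob :: "'o set"
  Ar :: "'a set"
  Dom :: "'a \<Rightarrow> 'o"
  Cod :: "'a \<Rightarrow> 'o"
  Idn :: "'o \<Rightarrow> 'a"
  Comp :: "'a \<Rightarrow> 'a \<Rightarrow> 'a" (infixl \<open>\<cdot>\<index>\<close> 70)

definition hom :: "('o, 'a) cat \<Rightarrow> 'o \<Rightarrow> 'o \<Rightarrow> 'a set" where
  "hom C A B = {f \<in> Ar C. Dom C f = A \<and> Cod C f = B}"

locale category =
  fixes C :: "('o, 'a) cat" (structure)
  assumes dom_ob: "f \<in> Ar C \<Longrightarrow> Dom C f \<in> Ob C"
    and cod_ob: "f \<in> Ar C \<Longrightarrow> Cod C f \<in> Ob C"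
    and idn_hom: "A \<in> Ob C \<Longrightarrow> Idn C A \<in> hom C A A"
    and comp_hom: "f \<in> hom C A B \<Longrightarrow> g \<in> hom C B D \<Longrightarrow> g \<cdot> f \<in> hom C A D"
    and comp_idn: "f \<in> hom C A B \<Longrightarrow> f \<cdot> Idn C A = f"
    and idn_comp: "f \<in> hom C A B \<Longrightarrow> Idn C B \<cdot> f = f"
    and comp_assoc: "f \<in> hom C A B \<Longrightarrow> g \<in> hom C B D \<Longrightarrow> k \<in> hom C D E
      \<Longrightarrow> (k \<cdot> g) \<cdot> f = k \<cdot> (g \<cdot> f)"

definition diagram ::
  "('i, 'j) cat \<Rightarrow> ('o, 'a) cat \<Rightarrow> ('i \<Rightarrow> 'o) \<Rightarrow> ('j \<Rightarrow> 'a) \<Rightarrow> bool" where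
  "diagram J C Fo Fa \<longleftrightarrow>
     category J \<and> category C \<and>
     (\<forall>j \<in> Ob J. Fo j \<in> Ob C \<and> Fa (Idn J j) = Idn C (Fo j)) \<and>
     (\<forall>a \<in> Ar J. Fa a \<in> hom C (Fo (Dom J a)) (Fo (Cod J a))) \<and>
     (\<forall>a \<in> Ar J. \<forall>b \<in> Ar J. Dom J b = Cod J a \<longrightarrow>
        Fa (b \<cdot>\<^bsub>J\<^esub> a) = Fa b \<cdot>\<^bsub>C\<^esub> Fa a)"

definition cone ::
  "('i, 'j) cat \<Rightarrow> ('o, 'a) cat \<Rightarrow> ('i \<Rightarrow> 'o) \<Rightarrow> ('j \<Rightarrow> 'a) \<Rightarrow> 'o \<Rightarrow> ('i \<Rightarrow> 'a) \<Rightarrow> bool" where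
  "cone J C Fo Fa L \<pi> \<longleftrightarrow>
     L \<in> Ob C \<and>
     (\<forall>j \<in> Ob J. \<pi> j \<in> hom C L (Fo j)) \<and>
     (\<forall>a \<in> Ar J. Fa a \<cdot>\<^bsub>C\<^esub> \<pi> (Dom J a) = \<pi> (Cod J a))"

definition limit_cone ::
  "('i, 'j) cat \<Rightarrow> ('o, 'a) cat \<Rightarrow> ('i \<Rightarrow> 'o) \<Rightarrow> ('j \<Rightarrow> 'a) \<Rightarrow> 'o \<Rightarrow> ('i \<Rightarrow> 'a) \<Rightarrow> bool" where
  "limit_cone J C Fo Fa L \<pi> \<longleftrightarrow>
     cone J C Fo Fa L \<pi> \<and>
     (\<forall>M \<rho>. cone J C Fo Fa M \<rho> \<longrightarrow>
        (\<exists>!u. u \<in> hom C M L \<and> (\<forall>j \<in> Ob J. \<pi> j \<cdot>\<^bsub>C\<^esub> u = \<rho> j)))"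

text \<open>Every finite category is isomorphic to one whose objects and arrows are natural
  numbers, so it suffices to let the index categories range over those.\<close>

definition has_finite_limits :: "('o, 'a) cat \<Rightarrow> bool" where
  "has_finite_limits C \<longleftrightarrow>
     (\<forall>(J :: (nat, nat) cat) Fo Fa. finite (Ob J) \<and> finite (Ar J) \<and> diagram J C Fo Fa \<longrightarrow>
        (\<exists>L \<pi>. limit_cone J C Fo Fa L \<pi>))"

context category
begin

definition monic :: "'a \<Rightarrow> bool" where
  "monic m \<longleftrightarrow> m \<in> Ar C \<and>
     (\<forall>X. \<forall>u \<in> hom C X (Dom C m). \<forall>v \<in> hom C X (Dom C m). m \<cdot> u = m \<cdot> v \<longrightarrow> u = v)"

definition isomorphism :: "'a \<Rightarrow> bool" where
  "isomorphism f \<longleftrightarrow> f \<in> Ar C \<and>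
     (\<exists>g \<in> hom C (Cod C f) (Dom C f).
        g \<cdot> f = Idn C (Dom C f) \<and> f \<cdot> g = Idn C (Cod C f))"

definition zero_object :: "'o \<Rightarrow> bool" where
  "zero_object Z \<longleftrightarrow> Z \<in> Ob C \<and>
     (\<forall>X \<in> Ob C. (\<exists>!f. f \<in> hom C X Z) \<and> (\<exists>!f. f \<in> hom C Z X))"

definition zero_arrow :: "'o \<Rightarrow> 'o \<Rightarrow> 'a" where
  "zero_arrow A B =
     (THE f. \<exists>Z g k. zero_object Z \<and> g \<in> hom C A Z \<and> k \<in> hom C Z B \<and> f = k \<cdot> g)"

definition is_pullback :: "'a \<Rightarrow> 'a \<Rightarrow> 'a \<Rightarrow> 'a \<Rightarrow> bool" where
  "is_pullback f g p q \<longleftrightarrow>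
     f \<in> Ar C \<and> g \<in> Ar C \<and> Cod C f = Cod C g \<and>
     p \<in> hom C (Dom C p) (Dom C f) \<and> q \<in> hom C (Dom C p) (Dom C g) \<and> f \<cdot> p = g \<cdot> q \<and>
     (\<forall>X. \<forall>u \<in> hom C X (Dom C f). \<forall>v \<in> hom C X (Dom C g). f \<cdot> u = g \<cdot> v \<longrightarrow>
        (\<exists>!w. w \<in> hom C X (Dom C p) \<and> p \<cdot> w = u \<and> q \<cdot> w = v))"

definition is_coequalizer :: "'a \<Rightarrow> 'a \<Rightarrow> 'a \<Rightarrow> bool" where
  "is_coequalizer f g e \<longleftrightarrow>
     f \<in> Ar C \<and> g \<in> hom C (Dom C f) (Cod C f) \<and>
     e \<in> hom C (Cod C f) (Cod C e) \<and> e \<cdot> f = e \<cdot> g \<and>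
     (\<forall>X. \<forall>u \<in> hom C (Cod C f) X. u \<cdot> f = u \<cdot> g \<longrightarrow>
        (\<exists>!w. w \<in> hom C (Cod C e) X \<and> w \<cdot> e = u))"

definition regular_epi :: "'a \<Rightarrow> bool" where
  "regular_epi e \<longleftrightarrow> (\<exists>f g. is_coequalizer f g e)"

definition is_kernel_pair :: "'a \<Rightarrow> 'a \<Rightarrow> 'a \<Rightarrow> bool" where
  "is_kernel_pair f p q \<longleftrightarrow> is_pullback f f p q"

definition is_kernel :: "'a \<Rightarrow> 'a \<Rightarrow> bool" where
  "is_kernel f k \<longleftrightarrow>
     f \<in> Ar C \<and> k \<in> hom C (Dom C k) (Dom C f) \<and>
     f \<cdot> k = zero_arrow (Dom C k) (Cod C f) \<and>
     (\<forall>X. \<forall>u \<in> hom C X (Dom C f). f \<cdot> u = zero_arrow X (Cod C f) \<longrightarrow>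
        (\<exists>!w. w \<in> hom C X (Dom C k) \<and> k \<cdot> w = u))"

definition is_coproduct :: "'o \<Rightarrow> 'o \<Rightarrow> 'a \<Rightarrow> 'a \<Rightarrow> bool" where
  "is_coproduct A B i j \<longleftrightarrow>
     i \<in> hom C A (Cod C i) \<and> j \<in> hom C B (Cod C i) \<and>
     (\<forall>X. \<forall>u \<in> hom C A X. \<forall>v \<in> hom C B X.
        (\<exists>!w. w \<in> hom C (Cod C i) X \<and> w \<cdot> i = u \<and> w \<cdot> j = v))"

text \<open>An internal equivalence relation \<open>(r\<^sub>1, r\<^sub>2) : R \<rightarrow> X \<times> X\<close>, given by its two
  projections.\<close>

definition equivalence_relation :: "'a \<Rightarrow> 'a \<Rightarrow> bool" where
  "equivalence_relation r1 r2 \<longleftrightarrow>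
     (\<exists>R X. r1 \<in> hom C R X \<and> r2 \<in> hom C R X \<and>
       (\<forall>Y. \<forall>u \<in> hom C Y R. \<forall>v \<in> hom C Y R.
          r1 \<cdot> u = r1 \<cdot> v \<and> r2 \<cdot> u = r2 \<cdot> v \<longrightarrow> u = v) \<and>
       (\<exists>d \<in> hom C X R. r1 \<cdot> d = Idn C X \<and> r2 \<cdot> d = Idn C X) \<and>
       (\<exists>s \<in> hom C R R. r1 \<cdot> s = r2 \<and> r2 \<cdot> s = r1) \<and>
       (\<forall>p q. is_pullback r2 r1 p q \<longrightarrow>
          (\<exists>t \<in> hom C (Dom C p) R. r1 \<cdot> t = r1 \<cdot> p \<and> r2 \<cdot> t = r2 \<cdot> q)))"

definition point :: "'o \<Rightarrow> 'o \<times> 'a \<times> 'a \<Rightarrow> bool" where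
  "point B = (\<lambda>(A, p, s). p \<in> hom C A B \<and> s \<in> hom C B A \<and> p \<cdot> s = Idn C B)"

definition point_arrow :: "'o \<times> 'a \<times> 'a \<Rightarrow> 'o \<times> 'a \<times> 'a \<Rightarrow> 'a \<Rightarrow> bool" where
  "point_arrow = (\<lambda>(A, p, s) (A', p', s') f.
     f \<in> hom C A A' \<and> p' \<cdot> f = p \<and> f \<cdot> s = s')"

end


section \<open>Semi-abelian categories\<close>

locale pointed_category = category +
  assumes zero_ex: "\<exists>Z. zero_object Z"

locale regular_category = category +
  assumes finite_limits: "has_finite_limits C"
    and kernel_pair_coequalizer: "is_kernel_pair f p q \<Longrightarrow> \<exists>e. is_coequalizer p q e"
    and regular_epi_stable: "regular_epi e \<Longrightarrow> is_pullback f e p q \<Longrightarrow> regular_epi p"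

locale exact_category = regular_category +
  assumes effective: "equivalence_relation r1 r2 \<Longrightarrow> \<exists>f. is_kernel_pair f r1 r2"

text \<open>Protomodularity: for each \<open>v : E \<rightarrow> B\<close>, the change-of-base functor
  \<open>v\<^sup>* : Pt\<^sub>B \<rightarrow> Pt\<^sub>E\<close>, given by pulling back along \<open>v\<close>, reflects isomorphisms.
  Below \<open>(q, a)\<close> and \<open>(q', a')\<close> are the pullbacks of \<open>p\<close> and \<open>p'\<close> along \<open>v\<close>, and \<open>g\<close> is
  the arrow \<open>v\<^sup>* f\<close>. An arrow of points is an isomorphism of points exactly if it is one in
  the category itself.\<close>

locale protomodular_category = category +
  assumes finite_limits: "has_finite_limits C"
    and change_of_base_reflects_isos:
      "v \<in> hom C E B \<Longrightarrow> point B (A, p, s) \<Longrightarrow> point B (A', p', s') \<Longrightarrow>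
       point_arrow (A, p, s) (A', p', s') f \<Longrightarrow>
       is_pullback v p q a \<Longrightarrow> is_pullback v p' q' a' \<Longrightarrow>
       g \<in> hom C (Dom C q) (Dom C q') \<Longrightarrow> q' \<cdot> g = q \<Longrightarrow> a' \<cdot> g = f \<cdot> a \<Longrightarrow>
       isomorphism g \<Longrightarrow> isomorphism f"

text \<open>Finite coproducts: the empty one is the zero object.\<close>

locale semi_abelian_category = pointed_category + exact_category + protomodular_category +
  assumes coproduct_ex: "A \<in> Ob C \<Longrightarrow> B \<in> Ob C \<Longrightarrow> \<exists>i j. is_coproduct A B i j"


section \<open>Internal actions\<close>

text \<open>Coproducts and kernels are only unique up to isomorphism; as usual, some choice of
  them is fixed. The notion of characteristic subobject does not depend on it.\<close>

context category
begin

definition coprod_inj :: "'o \<Rightarrow> 'o \<Rightarrow> 'a \<times> 'a" where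
  "coprod_inj A B = (SOME (i, j). is_coproduct A B i j)"

definition inl :: "'o \<Rightarrow> 'o \<Rightarrow> 'a" where
  "inl A B = fst (coprod_inj A B)"

definition inr :: "'o \<Rightarrow> 'o \<Rightarrow> 'a" where
  "inr A B = snd (coprod_inj A B)"

definition coprod :: "'o \<Rightarrow> 'o \<Rightarrow> 'o" where
  "coprod A B = Cod C (inl A B)"

definition copair :: "'a \<Rightarrow> 'a \<Rightarrow> 'a" where
  "copair u v = (THE w. w \<in> hom C (coprod (Dom C u) (Dom C v)) (Cod C u) \<and>
     w \<cdot> inl (Dom C u) (Dom C v) = u \<and> w \<cdot> inr (Dom C u) (Dom C v) = v)"

definition ker :: "'a \<Rightarrow> 'a" where
  "ker f = (SOME k. is_kernel f k)"

text \<open>The functor \<open>Ker\<^sub>B\<close> on objects and on an arrow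
  \<open>f : (A, p, s) \<rightarrow> (A', p', s')\<close> of points.\<close>

definition Ker_ob :: "'o \<times> 'a \<times> 'a \<Rightarrow> 'o" where
  "Ker_ob = (\<lambda>(A, p, s). Dom C (ker p))"

definition Ker_ar :: "'o \<times> 'a \<times> 'a \<Rightarrow> 'o \<times> 'a \<times> 'a \<Rightarrow> 'a \<Rightarrow> 'a" where
  "Ker_ar = (\<lambda>(A, p, s) (A', p', s') f.
     THE u. u \<in> hom C (Dom C (ker p)) (Dom C (ker p')) \<and> ker p' \<cdot> u = f \<cdot> ker p)"

text \<open>Its left adjoint \<open>B + (-)\<close>, and the unit and counit of the adjunction.\<close>

definition free_point :: "'o \<Rightarrow> 'o \<Rightarrow> 'o \<times> 'a \<times> 'a" where
  "free_point B X = (coprod B X, copair (Idn C B) (zero_arrow X B), inl B X)"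

definition free_point_ar :: "'o \<Rightarrow> 'a \<Rightarrow> 'a" where
  "free_point_ar B f = copair (inl B (Cod C f)) (inr B (Cod C f) \<cdot> f)"

definition flat :: "'o \<Rightarrow> 'o \<Rightarrow> 'o" where
  "flat B X = Ker_ob (free_point B X)"

definition flat_unit :: "'o \<Rightarrow> 'o \<Rightarrow> 'a" where
  "flat_unit B X = (THE u. u \<in> hom C X (flat B X) \<and>
     ker (copair (Idn C B) (zero_arrow X B)) \<cdot> u = inr B X)"

definition point_counit :: "'o \<times> 'a \<times> 'a \<Rightarrow> 'a" where
  "point_counit = (\<lambda>(A, p, s). copair s (ker p))"

text \<open>The remaining data of the induced monad \<open>B \<flat> (-)\<close>: its effect \<open>1\<^sub>B \<flat> f\<close> on arrows and
  its multiplication, the image under \<open>Ker\<^sub>B\<close> of the counit at the free point on \<open>X\<close>.\<close>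

definition flat_ar :: "'o \<Rightarrow> 'a \<Rightarrow> 'a" where
  "flat_ar B f =
     Ker_ar (free_point B (Dom C f)) (free_point B (Cod C f)) (free_point_ar B f)"

definition flat_mult :: "'o \<Rightarrow> 'o \<Rightarrow> 'a" where
  "flat_mult B X =
     Ker_ar (free_point B (flat B X)) (free_point B X) (point_counit (free_point B X))"

definition action :: "'o \<Rightarrow> 'o \<Rightarrow> 'a \<Rightarrow> bool" where
  "action B X \<xi> \<longleftrightarrow>
     B \<in> Ob C \<and> X \<in> Ob C \<and> \<xi> \<in> hom C (flat B X) X \<and>
     \<xi> \<cdot> flat_unit B X = Idn C X \<and>
     \<xi> \<cdot> flat_mult B X = \<xi> \<cdot> flat_ar B \<xi>"


section \<open>Normal and characteristic subobjects\<close>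

text \<open>Subobjects are given by representing monomorphisms; both notions are invariant under
  the equivalence of monomorphisms.\<close>

definition normal_subobject :: "'a \<Rightarrow> bool" where
  "normal_subobject m \<longleftrightarrow> monic m \<and> (\<exists>f. is_kernel f m)"

definition characteristic_subobject :: "'a \<Rightarrow> bool" where
  "characteristic_subobject h \<longleftrightarrow> monic h \<and>
     (\<forall>B \<xi>. action B (Cod C h) \<xi> \<longrightarrow>
        (\<exists>!\<xi>'. action B (Dom C h) \<xi>' \<and> h \<cdot> \<xi>' = \<xi> \<cdot> flat_ar B h))"

end

end

theory Submission
  imports Defs
begin

text \<open>
  Let \<open>R\<close> be the kernel pair of an arrow with kernel \<open>k\<close>. It is a point over \<open>G\<close> with kernel
  \<open>K\<close>, and so carries an action \<open>\<xi>\<close> of \<open>G\<close> on \<open>K\<close> (conjugation), which restricts to \<open>H\<close> because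
  \<open>H\<close> is characteristic. Let \<open>A\<close> be the image of \<open>G + H \<rightarrow> R\<close>. By stability of regular
  epimorphisms the kernel of its first projection is the image of \<open>G \<flat> H \<rightarrow> G \<flat> K \<rightarrow> K\<close>, which
  by the existence of the restricted action is just \<open>H\<close>. Now \<open>A\<close> is a reflexive relation on \<open>G\<close>,
  hence an equivalence relation by protomodularity, hence by exactness the kernel pair of some
  arrow \<open>g\<close>. The kernel of \<open>g\<close> is the class of \<open>0\<close> under \<open>A\<close>, that is \<open>H\<close>. Thus neither the
  semidirect product nor the monadicity of \<open>Ker\<^sub>G\<close> is needed.
\<close>

section \<open>Arrows and pullbacks\<close>

context category
begin

lemma hom_obs: "f \<in> hom C A B \<Longrightarrow> A \<in> Ob C \<and> B \<in> Ob C"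
  using dom_ob cod_ob by (auto simp: hom_def)

lemma hom_ar: "f \<in> hom C A B \<Longrightarrow> f \<in> Ar C"
  by (simp add: hom_def)

lemma hom_dom: "f \<in> hom C A B \<Longrightarrow> Dom C f = A"
  by (simp add: hom_def)

lemma hom_cod: "f \<in> hom C A B \<Longrightarrow> Cod C f = B"
  by (simp add: hom_def)

section \<open>Monomorphisms and regular epimorphisms\<close>

lemma monicI:
  assumes "m \<in> hom C A B"
    and "\<And>X u v. u \<in> hom C X A \<Longrightarrow> v \<in> hom C X A \<Longrightarrow> m \<cdot> u = m \<cdot> v \<Longrightarrow> u = v"
  shows "monic m"
  unfolding monic_def using assms by (auto simp: hom_ar hom_dom)

lemma monicD:
  assumes "monic m" "m \<in> hom C A B" "u \<in> hom C X A" "v \<in> hom C X A" "m \<cdot> u = m \<cdot> v"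
  shows "u = v"
  using assms unfolding monic_def by (auto simp: hom_dom)

lemma monic_comp:
  assumes "monic m" "m \<in> hom C A B" "monic n" "n \<in> hom C B D"
  shows "monic (n \<cdot> m)"
proof (rule monicI)
  show "n \<cdot> m \<in> hom C A D"
    using assms comp_hom by blast
  fix X u v
  assume uv: "u \<in> hom C X A" "v \<in> hom C X A" "(n \<cdot> m) \<cdot> u = (n \<cdot> m) \<cdot> v"
  then have "n \<cdot> (m \<cdot> u) = n \<cdot> (m \<cdot> v)"
    using assms comp_assoc by metis
  then have "m \<cdot> u = m \<cdot> v"
    using monicD assms uv comp_hom by meson
  then show "u = v"
    using monicD assms uv by meson
qed

text \<open>Regular epimorphisms are epic: \<open>u\<close> and \<open>v\<close> both solve the
  factorisation problem for \<open>u \<cdot> e\<close>, whose solution is unique.\<close>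

lemma regular_epi_cancel:
  assumes "regular_epi e" "e \<in> hom C A B" "u \<in> hom C B X" "v \<in> hom C B X" "u \<cdot> e = v \<cdot> e"
  shows "u = v"
proof -
  obtain f g where c: "is_coequalizer f g e"
    using assms(1) unfolding regular_epi_def by blast
  have f: "f \<in> hom C (Dom C f) A" and g: "g \<in> hom C (Dom C f) A"
    and eq: "e \<cdot> f = e \<cdot> g" and A: "Cod C f = A"
    using c assms(2) unfolding is_coequalizer_def by (auto simp: hom_def)
  have "u \<cdot> e \<in> hom C A X"
    using comp_hom assms(2,3) by blast
  moreover have "(u \<cdot> e) \<cdot> f = (u \<cdot> e) \<cdot> g"
    using eq comp_assoc[OF f assms(2,3)] comp_assoc[OF g assms(2,3)] by simp
  ultimately have "\<exists>!w. w \<in> hom C B X \<and> w \<cdot> e = u \<cdot> e"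
    using c assms(2) A unfolding is_coequalizer_def by (auto simp: hom_cod)
  then show ?thesis
    using assms by metis
qed

text \<open>The pair whose coequalizer is \<open>e\<close> is itself identified by \<open>e\<close>,
  so the last hypothesis applies to it. Quantifying over all such pairs avoids naming a particular
  one.\<close>

lemma regular_epi_factor:
  assumes "regular_epi e" "e \<in> hom C A B" "u \<in> hom C A X"
    and "\<And>Y a b. a \<in> hom C Y A \<Longrightarrow> b \<in> hom C Y A \<Longrightarrow> e \<cdot> a = e \<cdot> b \<Longrightarrow> u \<cdot> a = u \<cdot> b"
  shows "\<exists>w. w \<in> hom C B X \<and> w \<cdot> e = u"
proof -
  obtain f g where c: "is_coequalizer f g e"
    using assms(1) unfolding regular_epi_def by blast
  have f: "f \<in> hom C (Dom C f) A" and g: "g \<in> hom C (Dom C f) A"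
    and eq: "e \<cdot> f = e \<cdot> g" and A: "Cod C f = A"
    using c assms(2) unfolding is_coequalizer_def by (auto simp: hom_def)
  then have "u \<cdot> f = u \<cdot> g"
    using assms(4) by blast
  then have "\<exists>!w. w \<in> hom C B X \<and> w \<cdot> e = u"
    using c assms(2,3) A unfolding is_coequalizer_def by (auto simp: hom_cod)
  then show ?thesis
    by blast
qed

section \<open>Pullbacks in terms of generalized elements\<close>

lemma pullback_homs:
  assumes "is_pullback f g p q" "f \<in> hom C A X" "g \<in> hom C B X"
  obtains P where "p \<in> hom C P A" "q \<in> hom C P B" "f \<cdot> p = g \<cdot> q"
  using assms unfolding is_pullback_def by (auto simp: hom_def)

lemma pullback_factor:
  assumes "is_pullback f g p q" "f \<in> hom C A X" "g \<in> hom C B X" "p \<in> hom C P A"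
    and "u \<in> hom C Y A" "v \<in> hom C Y B" "f \<cdot> u = g \<cdot> v"
  obtains w where "w \<in> hom C Y P" "p \<cdot> w = u" "q \<cdot> w = v"
proof -
  have "\<exists>!w. w \<in> hom C Y P \<and> p \<cdot> w = u \<and> q \<cdot> w = v"
    using assms unfolding is_pullback_def by (auto simp: hom_dom)
  then show ?thesis
    using that by blast
qed

lemma pullback_jointly_monic:
  assumes "is_pullback f g p q" "p \<in> hom C P A"
    and "u \<in> hom C Y P" "v \<in> hom C Y P" "p \<cdot> u = p \<cdot> v" "q \<cdot> u = q \<cdot> v"
  shows "u = v"
proof -
  have ar: "f \<in> hom C A (Cod C f)" "g \<in> hom C (Dom C g) (Cod C f)" "q \<in> hom C P (Dom C g)"
    and fg: "f \<cdot> p = g \<cdot> q"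
    using assms(1,2) unfolding is_pullback_def by (auto simp: hom_def)
  have "p \<cdot> u \<in> hom C Y A" "q \<cdot> u \<in> hom C Y (Dom C g)"
    using ar assms comp_hom by blast+
  moreover have "f \<cdot> (p \<cdot> u) = g \<cdot> (q \<cdot> u)"
    using fg comp_assoc[OF assms(3,2) ar(1)] comp_assoc[OF assms(3) ar(3,2)] by simp
  ultimately have "\<exists>!w. w \<in> hom C Y P \<and> p \<cdot> w = p \<cdot> u \<and> q \<cdot> w = q \<cdot> u"
    using assms(1) hom_dom[OF ar(1)] hom_dom[OF assms(2)] unfolding is_pullback_def by auto
  then show ?thesis
    using assms by metis
qed

lemma is_pullbackI:
  assumes "f \<in> hom C A X" "g \<in> hom C B X" "p \<in> hom C P A" "q \<in> hom C P B" "f \<cdot> p = g \<cdot> q"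
    and "\<And>Y u v. u \<in> hom C Y A \<Longrightarrow> v \<in> hom C Y B \<Longrightarrow> f \<cdot> u = g \<cdot> v \<Longrightarrow>
      \<exists>w. w \<in> hom C Y P \<and> p \<cdot> w = u \<and> q \<cdot> w = v"
    and "\<And>Y u v. u \<in> hom C Y P \<Longrightarrow> v \<in> hom C Y P \<Longrightarrow> p \<cdot> u = p \<cdot> v \<Longrightarrow> q \<cdot> u = q \<cdot> v \<Longrightarrow>
      u = v"
  shows "is_pullback f g p q"
proof -
  have "\<exists>!w. w \<in> hom C Y P \<and> p \<cdot> w = u \<and> q \<cdot> w = v"
    if "u \<in> hom C Y A" "v \<in> hom C Y B" "f \<cdot> u = g \<cdot> v" for Y u v
    using assms(6)[OF that] assms(7)[of _ Y] by metis
  then show ?thesis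
    using assms(1-5) unfolding is_pullback_def by (simp add: hom_def)
qed

text \<open>The shape \<open>0 \<rightarrow> 2 \<leftarrow> 1\<close>: the arrows \<open>0, 1, 2\<close> are the identities, \<open>3 : 0 \<rightarrow> 2\<close> and
  \<open>4 : 1 \<rightarrow> 2\<close>.\<close>

definition cospan :: "(nat, nat) cat" where
  "cospan = \<lparr>Ob = {0, 1, 2}, Ar = {0, 1, 2, 3, 4},
     Dom = (\<lambda>a. if a = 3 then 0 else if a = 4 then 1 else a),
     Cod = (\<lambda>a. if a = 3 \<or> a = 4 then 2 else a),
     Idn = (\<lambda>a. a), Comp = (\<lambda>b a. if b < 3 then a else b)\<rparr>"

lemma category_cospan: "category cospan"
  by unfold_locales (auto simp: cospan_def hom_def split: if_splits)

lemma pullback_ex: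
  assumes lim: "has_finite_limits C" and f: "f \<in> hom C A X" and g: "g \<in> hom C B X"
  obtains P p q where "is_pullback f g p q" "p \<in> hom C P A" "q \<in> hom C P B" "f \<cdot> p = g \<cdot> q"
proof -
  have obs: "A \<in> Ob C" "B \<in> Ob C" "X \<in> Ob C"
    using hom_obs f g by blast+
  define Fo :: "nat \<Rightarrow> 'o" where "Fo = (\<lambda>i. if i = 0 then A else if i = 1 then B else X)"
  define Fa where
    "Fa = (\<lambda>a :: nat. if a = 3 then f else if a = 4 then g else Idn C (Fo a))"
  have "diagram cospan C Fo Fa"
    unfolding diagram_def using obs f g category_cospan category_axioms
    by (auto simp: cospan_def Fo_def Fa_def idn_hom comp_idn[OF f] comp_idn[OF g]
        idn_comp[OF f] idn_comp[OF g] comp_idn[OF idn_hom])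
  moreover have "finite (Ob cospan)" "finite (Ar cospan)"
    by (auto simp: cospan_def)
  ultimately obtain L \<pi> where L: "limit_cone cospan C Fo Fa L \<pi>"
    using lim unfolding has_finite_limits_def by blast
  have p: "\<pi> 0 \<in> hom C L A" "\<pi> 1 \<in> hom C L B" and x: "f \<cdot> \<pi> 0 = \<pi> 2" "g \<cdot> \<pi> 1 = \<pi> 2"
    using L unfolding limit_cone_def cone_def by (auto simp: cospan_def Fo_def Fa_def)
  have univ: "\<exists>!w. w \<in> hom C Y L \<and> \<pi> 0 \<cdot> w = u \<and> \<pi> 1 \<cdot> w = v"
    if u: "u \<in> hom C Y A" and v: "v \<in> hom C Y B" and e: "f \<cdot> u = g \<cdot> v" for Y u v
  proof -
    \<comment> \<open>The leg at vertex \<open>2\<close> is forced: it is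
      \<open>f \<cdot> u\<close>, which equals \<open>g \<cdot> v\<close>.\<close>
    define \<rho> where "\<rho> = (\<lambda>i :: nat. if i = 0 then u else if i = 1 then v else f \<cdot> u)"
    have fu: "f \<cdot> u \<in> hom C Y X"
      using u f comp_hom by blast
    have "cone cospan C Fo Fa Y \<rho>"
      unfolding cone_def using u v e fu hom_obs[OF u] idn_comp[OF u] idn_comp[OF v] idn_comp[OF fu]
      by (auto simp: cospan_def Fo_def Fa_def \<rho>_def)
    then have "\<exists>!w. w \<in> hom C Y L \<and> (\<forall>j \<in> Ob cospan. \<pi> j \<cdot> w = \<rho> j)"
      using L unfolding limit_cone_def by blast
    \<comment> \<open>The condition at vertex \<open>2\<close> follows from the one at
      \<open>0\<close>, so the limit property reduces to that of a pullback.\<close>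
    moreover have "(\<forall>j \<in> Ob cospan. \<pi> j \<cdot> w = \<rho> j) \<longleftrightarrow> \<pi> 0 \<cdot> w = u \<and> \<pi> 1 \<cdot> w = v"
      if w: "w \<in> hom C Y L" for w
    proof -
      have "\<pi> 2 \<cdot> w = f \<cdot> (\<pi> 0 \<cdot> w)"
        using x p w f comp_assoc by metis
      then show ?thesis
        by (auto simp: cospan_def \<rho>_def)
    qed
    ultimately show ?thesis
      by (smt (verit))
  qed
  have "is_pullback f g (\<pi> 0) (\<pi> 1)"
    using univ p x f g unfolding is_pullback_def by (auto simp: hom_def)
  then show ?thesis
    using that p x by simp
qed

end


section \<open>Zero arrows and kernels\<close>

context pointed_category
begin

section \<open>The zero object and zero arrows\<close>

lemma to_zero:
  assumes "zero_object Z" "A \<in> Ob C"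
  obtains t where "t \<in> hom C A Z"
  using assms unfolding zero_object_def by metis

lemma from_zero:
  assumes "zero_object Z" "A \<in> Ob C"
  obtains t where "t \<in> hom C Z A"
  using assms unfolding zero_object_def by metis

lemma to_zero_unique:
  assumes "zero_object Z" "f \<in> hom C A Z" "g \<in> hom C A Z"
  shows "f = g"
  using assms hom_obs unfolding zero_object_def by metis

lemma from_zero_unique:
  assumes "zero_object Z" "f \<in> hom C Z A" "g \<in> hom C Z A"
  shows "f = g"
  using assms hom_obs unfolding zero_object_def by metis

text \<open>The comparison arrow \<open>i\<close> between two zero objects shows that the composite
  does not depend on the zero object, so the description in \<open>zero_arrow\<close> is well
  defined.\<close>

lemma zero_arrow_eq:
  assumes Z: "zero_object Z" and g: "g \<in> hom C A Z" and k: "k \<in> hom C Z B"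
  shows "zero_arrow A B = k \<cdot> g"
  unfolding zero_arrow_def
proof (rule the_equality)
  show "\<exists>Z' g' k'. zero_object Z' \<and> g' \<in> hom C A Z' \<and> k' \<in> hom C Z' B \<and> k \<cdot> g = k' \<cdot> g'"
    using assms by blast
next
  fix f
  assume "\<exists>Z' g' k'. zero_object Z' \<and> g' \<in> hom C A Z' \<and> k' \<in> hom C Z' B \<and> f = k' \<cdot> g'"
  then obtain Z' g' k' where Z': "zero_object Z'" and g': "g' \<in> hom C A Z'"
    and k': "k' \<in> hom C Z' B" and f: "f = k' \<cdot> g'"
    by blast
  obtain i where i: "i \<in> hom C Z Z'"
    using from_zero[OF Z] Z' unfolding zero_object_def by metis
  have "i \<cdot> g \<in> hom C A Z'" "k' \<cdot> i \<in> hom C Z B"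
    using i g k' comp_hom by blast+
  then have "i \<cdot> g = g'" "k' \<cdot> i = k"
    using to_zero_unique[OF Z'] from_zero_unique[OF Z] g' k by blast+
  then show "f = k \<cdot> g"
    using f comp_assoc[OF g i k'] by simp
qed

lemma zero_arrow_factors:
  assumes "A \<in> Ob C" "B \<in> Ob C"
  obtains Z g k where "zero_object Z" "g \<in> hom C A Z" "k \<in> hom C Z B" "zero_arrow A B = k \<cdot> g"
proof -
  obtain Z where Z: "zero_object Z"
    using zero_ex by blast
  obtain g where "g \<in> hom C A Z"
    using to_zero[OF Z assms(1)] .
  moreover obtain k where "k \<in> hom C Z B"
    using from_zero[OF Z assms(2)] .
  ultimately show ?thesis
    using that Z zero_arrow_eq by blast
qed

lemma zero_arrow_hom: "A \<in> Ob C \<Longrightarrow> B \<in> Ob C \<Longrightarrow> zero_arrow A B \<in> hom C A B"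
  by (erule (1) zero_arrow_factors) (auto intro: comp_hom)

lemma comp_zero_arrow:
  assumes "A \<in> Ob C" "f \<in> hom C B D"
  shows "f \<cdot> zero_arrow A B = zero_arrow A D"
proof -
  obtain Z g k where Z: "zero_object Z" "g \<in> hom C A Z" "k \<in> hom C Z B" "zero_arrow A B = k \<cdot> g"
    using zero_arrow_factors assms hom_obs by metis
  then have "f \<cdot> zero_arrow A B = (f \<cdot> k) \<cdot> g"
    using comp_assoc assms by simp
  also have "\<dots> = zero_arrow A D"
    using zero_arrow_eq Z comp_hom assms by metis
  finally show ?thesis .
qed

lemma zero_arrow_comp:
  assumes "D \<in> Ob C" "f \<in> hom C A B"
  shows "zero_arrow B D \<cdot> f = zero_arrow A D"
proof -
  obtain Z g k where Z: "zero_object Z" "g \<in> hom C B Z" "k \<in> hom C Z D" "zero_arrow B D = k \<cdot> g"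
    using zero_arrow_factors assms hom_obs by metis
  then have "zero_arrow B D \<cdot> f = k \<cdot> (g \<cdot> f)"
    using comp_assoc assms by simp
  also have "\<dots> = zero_arrow A D"
    using zero_arrow_eq Z comp_hom assms by metis
  finally show ?thesis .
qed

section \<open>Kernels\<close>

lemma kernel_hom:
  assumes "is_kernel f k" "f \<in> hom C A B"
  obtains N where "k \<in> hom C N A" "f \<cdot> k = zero_arrow N B"
  using assms unfolding is_kernel_def by (auto simp: hom_dom hom_cod)

lemma kernel_zero:
  assumes "is_kernel f k" "f \<in> hom C A B" "k \<in> hom C N A"
  shows "f \<cdot> k = zero_arrow N B"
  using assms unfolding is_kernel_def by (simp add: hom_def)

lemma kernel_factor:
  assumes "is_kernel f k" "f \<in> hom C A B" "k \<in> hom C N A"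
    and "u \<in> hom C X A" "f \<cdot> u = zero_arrow X B"
  obtains w where "w \<in> hom C X N" "k \<cdot> w = u"
proof -
  have "\<exists>!w. w \<in> hom C X N \<and> k \<cdot> w = u"
    using assms unfolding is_kernel_def by (auto simp: hom_dom hom_cod)
  then show ?thesis
    using that by blast
qed

lemma kernel_monic:
  assumes "is_kernel f k"
  shows "monic k"
proof -
  define A B N where "A = Dom C f" and "B = Cod C f" and "N = Dom C k"
  have f: "f \<in> hom C A B" and k: "k \<in> hom C N A" and z: "f \<cdot> k = zero_arrow N B"
    using assms unfolding is_kernel_def A_def B_def N_def by (auto simp: hom_def)
  show ?thesis
  proof (rule monicI[OF k])
    fix X u v
    assume uv: "u \<in> hom C X N" "v \<in> hom C X N" "k \<cdot> u = k \<cdot> v"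
    have "f \<cdot> (k \<cdot> u) = (f \<cdot> k) \<cdot> u"
      using comp_assoc[OF uv(1) k f] by simp
    also have "\<dots> = zero_arrow X B"
      using z zero_arrow_comp uv hom_obs[OF f] by simp
    finally have "\<exists>!w. w \<in> hom C X N \<and> k \<cdot> w = k \<cdot> u"
      using assms comp_hom[OF uv(1) k] unfolding is_kernel_def A_def B_def N_def by auto
    then show "u = v"
      using uv by metis
  qed
qed

lemma is_kernelI:
  assumes "f \<in> hom C A B" "k \<in> hom C N A" "f \<cdot> k = zero_arrow N B" "monic k"
    and "\<And>X u. u \<in> hom C X A \<Longrightarrow> f \<cdot> u = zero_arrow X B \<Longrightarrow> \<exists>w. w \<in> hom C X N \<and> k \<cdot> w = u"
  shows "is_kernel f k"
proof -
  have "\<exists>!w. w \<in> hom C X N \<and> k \<cdot> w = u"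
    if "u \<in> hom C X A" "f \<cdot> u = zero_arrow X B" for X u
    using assms(5)[OF that] monicD[OF assms(4,2), of _ X] by metis
  then show ?thesis
    using assms(1-3) unfolding is_kernel_def by (simp add: hom_def)
qed

text \<open>Fits kernels to the protomodularity axiom: change of base along the arrow from the zero
  object sends a point to its kernel.\<close>

lemma kernel_is_pullback:
  assumes ker: "is_kernel f k" and f: "f \<in> hom C A B" and k: "k \<in> hom C N A"
    and Z: "zero_object Z" and z: "z \<in> hom C Z B" and t: "t \<in> hom C N Z"
  shows "is_pullback z f t k"
proof (rule is_pullbackI[OF z f t k])
  have "f \<cdot> k = zero_arrow N B"
    using kernel_zero[OF ker f k] .
  then show "z \<cdot> t = f \<cdot> k"
    using zero_arrow_eq[OF Z t z] by simp
next
  fix Y u v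
  assume uv: "u \<in> hom C Y Z" "v \<in> hom C Y A" "z \<cdot> u = f \<cdot> v"
  then have "f \<cdot> v = zero_arrow Y B"
    using zero_arrow_eq[OF Z _ z] by simp
  then obtain w where w: "w \<in> hom C Y N" "k \<cdot> w = v"
    using kernel_factor[OF ker f k] uv by metis
  moreover have "t \<cdot> w = u"
    using to_zero_unique[OF Z comp_hom[OF w(1) t]] uv by blast
  ultimately show "\<exists>w. w \<in> hom C Y N \<and> t \<cdot> w = u \<and> k \<cdot> w = v"
    by blast
next
  fix Y u v
  assume "u \<in> hom C Y N" "v \<in> hom C Y N" "k \<cdot> u = k \<cdot> v"
  then show "u = v"
    using monicD[OF kernel_monic[OF ker] k] by blast
qed

lemma kernel_ex:
  assumes lim: "has_finite_limits C" and f: "f \<in> hom C A B"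
  obtains k where "is_kernel f k"
proof -
  obtain Z where Z: "zero_object Z"
    using zero_ex by blast
  obtain z where z: "z \<in> hom C Z B"
    using from_zero[OF Z] hom_obs[OF f] by blast
  obtain P t k where pb: "is_pullback z f t k" and t: "t \<in> hom C P Z" and k: "k \<in> hom C P A"
    and e: "z \<cdot> t = f \<cdot> k"
    using pullback_ex[OF lim z f] by metis
  have "is_kernel f k"
  proof (rule is_kernelI[OF f k])
    show "f \<cdot> k = zero_arrow P B"
      using e zero_arrow_eq[OF Z t z] by simp
    show "monic k"
    proof (rule monicI[OF k])
      fix X u v
      assume uv: "u \<in> hom C X P" "v \<in> hom C X P" "k \<cdot> u = k \<cdot> v"
      have "t \<cdot> u = t \<cdot> v"
        using to_zero_unique[OF Z comp_hom comp_hom, OF uv(1) t uv(2) t] .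
      then show "u = v"
        using pullback_jointly_monic[OF pb t] uv by blast
    qed
  next
    fix X u
    assume u: "u \<in> hom C X A" "f \<cdot> u = zero_arrow X B"
    obtain y where y: "y \<in> hom C X Z"
      using to_zero[OF Z] hom_obs[OF u(1)] by blast
    then have "z \<cdot> y = f \<cdot> u"
      using u zero_arrow_eq[OF Z y z] by simp
    then show "\<exists>w. w \<in> hom C X P \<and> k \<cdot> w = u"
      using pullback_factor[OF pb z f t y u(1)] by metis
  qed
  then show ?thesis
    using that by blast
qed

end

context category
begin

text \<open>With objects read off through \<open>Dom\<close> and \<open>Cod\<close> no intermediate
  object has to be guessed, so \<open>arrow_simps\<close> can rebracket composites by
  rewriting.\<close>

lemma comp_ar: "f \<in> Ar C \<Longrightarrow> g \<in> Ar C \<Longrightarrow> Dom C g = Cod C f \<Longrightarrow> g \<cdot> f \<in> Ar C"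
  and dom_comp: "f \<in> Ar C \<Longrightarrow> g \<in> Ar C \<Longrightarrow> Dom C g = Cod C f \<Longrightarrow> Dom C (g \<cdot> f) = Dom C f"
  and cod_comp: "f \<in> Ar C \<Longrightarrow> g \<in> Ar C \<Longrightarrow> Dom C g = Cod C f \<Longrightarrow> Cod C (g \<cdot> f) = Cod C g"
  using comp_hom[of f "Dom C f" "Cod C f" g "Cod C g"] by (auto simp: hom_def)

lemma comp_assoc_ar:
  assumes "f \<in> Ar C" "g \<in> Ar C" "k \<in> Ar C" "Dom C g = Cod C f" "Dom C k = Cod C g"
  shows "(k \<cdot> g) \<cdot> f = k \<cdot> (g \<cdot> f)"
  using assms comp_assoc[of f "Dom C f" "Cod C f" g "Cod C g" k "Cod C k"] by (simp add: hom_def)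

lemmas arrow_simps = hom_def comp_ar dom_comp cod_comp comp_assoc_ar

text \<open>The standard step of the later calculations: an equation between arrows is applied to a
  generalized element \<open>y\<close>.\<close>

lemma comp_eq_comp:
  assumes "g \<cdot> f = x" "f \<in> hom C A B" "g \<in> hom C B D" "y \<in> hom C X A"
  shows "g \<cdot> (f \<cdot> y) = x \<cdot> y"
  using comp_assoc[OF assms(4,2,3)] assms(1) by simp

text \<open>The product is the pullback over the zero object; any two arrows into the latter agree,
  so the commutativity condition is automatic.\<close>

lemma product_ex:
  assumes "has_finite_limits C" "zero_object Z" "A \<in> Ob C" "B \<in> Ob C"
  obtains P p q where "p \<in> hom C P A" "q \<in> hom C P B"
    "\<forall>X. \<forall>u \<in> hom C X A. \<forall>v \<in> hom C X B.
      \<exists>!w. w \<in> hom C X P \<and> p \<cdot> w = u \<and> q \<cdot> w = v"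
proof -
  obtain s where s: "s \<in> hom C A Z"
    using assms(2,3) unfolding zero_object_def by metis
  obtain t where t: "t \<in> hom C B Z"
    using assms(2,4) unfolding zero_object_def by metis
  obtain P p q where pb: "is_pullback s t p q" and p: "p \<in> hom C P A" and q: "q \<in> hom C P B"
    using pullback_ex[OF assms(1) s t] by metis
  have "\<exists>!w. w \<in> hom C X P \<and> p \<cdot> w = u \<and> q \<cdot> w = v"
    if uv: "u \<in> hom C X A" "v \<in> hom C X B" for X u v
  proof -
    have "s \<cdot> u \<in> hom C X Z" "t \<cdot> v \<in> hom C X Z"
      using comp_hom s t uv by blast+
    then have "s \<cdot> u = t \<cdot> v"
      using assms(2) hom_obs[OF uv(1)] unfolding zero_object_def by metis
    then show ?thesis
      using pb s t uv hom_dom[OF p] unfolding is_pullback_def by (auto simp: hom_dom)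
  qed
  then show ?thesis
    using that[OF p q] by blast
qed

end


section \<open>Image factorisations\<close>

context regular_category
begin

text \<open>\<open>e\<close> is the coequalizer of the kernel pair of \<open>w\<close>, and
  \<open>m\<close> is the induced arrow. That \<open>m\<close> is monic rests on the stability of
  regular epimorphisms under pullback.\<close>

lemma image_factorisation:
  assumes w: "w \<in> hom C A B"
  obtains I e m where "e \<in> hom C A I" "regular_epi e" "m \<in> hom C I B" "monic m" "m \<cdot> e = w"
proof -
  obtain R a b where kp: "is_pullback w w a b" and a: "a \<in> hom C R A" and b: "b \<in> hom C R A"
    and wab: "w \<cdot> a = w \<cdot> b"
    using pullback_ex[OF finite_limits w w] by metis
  obtain e where co: "is_coequalizer a b e"
    using kernel_pair_coequalizer kp unfolding is_kernel_pair_def by blast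
  define I where "I = Cod C e"
  have e: "e \<in> hom C A I" and eab: "e \<cdot> a = e \<cdot> b"
    using co a unfolding is_coequalizer_def I_def by (auto simp: hom_def)
  have re: "regular_epi e"
    using co unfolding regular_epi_def by blast
  have "\<exists>!m. m \<in> hom C I B \<and> m \<cdot> e = w"
    using co w wab hom_cod[OF a] unfolding is_coequalizer_def I_def by blast
  then obtain m where m: "m \<in> hom C I B" and me: "m \<cdot> e = w"
    by blast
  have e_eq: "e \<cdot> x = e \<cdot> y"
    if x: "x \<in> hom C Y A" and y: "y \<in> hom C Y A" and xy: "w \<cdot> x = w \<cdot> y" for Y x y
  proof -
    obtain z where z: "z \<in> hom C Y R" "a \<cdot> z = x" "b \<cdot> z = y"
      using pullback_factor[OF kp w w a x y xy] .
    have "e \<cdot> (a \<cdot> z) = e \<cdot> (b \<cdot> z)"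
      using eab comp_assoc[OF z(1) a e] comp_assoc[OF z(1) b e] by simp
    then show ?thesis
      using z by simp
  qed
  \<comment> \<open>Two arrows identified by \<open>m\<close> lift along \<open>e\<close> after composing with a regular epimorphism.\<close>
  have "monic m"
  proof (rule monicI[OF m])
    fix X u v
    assume u: "u \<in> hom C X I" and v: "v \<in> hom C X I" and uv: "m \<cdot> u = m \<cdot> v"
    obtain P y x where pb: "is_pullback u e y x" and y: "y \<in> hom C P X" and x: "x \<in> hom C P A"
      and ux: "u \<cdot> y = e \<cdot> x"
      using pullback_ex[OF finite_limits u e] by metis
    have vy: "v \<cdot> y \<in> hom C P I" and uy: "u \<cdot> y \<in> hom C P I"
      using u v y comp_hom by blast+
    obtain P' y' x' where pb': "is_pullback (v \<cdot> y) e y' x'" and y': "y' \<in> hom C P' P"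
      and x': "x' \<in> hom C P' A" and vx: "(v \<cdot> y) \<cdot> y' = e \<cdot> x'"
      using pullback_ex[OF finite_limits vy e] by metis
    have xy': "x \<cdot> y' \<in> hom C P' A"
      using x y' comp_hom by blast
    have "w \<cdot> (x \<cdot> y') = m \<cdot> ((e \<cdot> x) \<cdot> y')"
      unfolding me[symmetric] using m e x y' by (simp add: arrow_simps)
    also have "\<dots> = (m \<cdot> u) \<cdot> (y \<cdot> y')"
      unfolding ux[symmetric] using m u y y' by (simp add: arrow_simps)
    also have "\<dots> = m \<cdot> ((v \<cdot> y) \<cdot> y')"
      unfolding uv using m v y y' by (simp add: arrow_simps)
    also have "\<dots> = w \<cdot> x'"
      unfolding vx me[symmetric] using m e x' by (simp add: arrow_simps)
    finally have "e \<cdot> (x \<cdot> y') = e \<cdot> x'"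
      using e_eq xy' x' by blast
    then have "(u \<cdot> y) \<cdot> y' = (v \<cdot> y) \<cdot> y'"
      unfolding ux vx using comp_assoc[OF y' x e] by simp
    then have "u \<cdot> y = v \<cdot> y"
      using regular_epi_cancel[OF regular_epi_stable[OF re pb'] y' uy vy] by blast
    then show "u = v"
      using regular_epi_cancel[OF regular_epi_stable[OF re pb] y u v] by blast
  qed
  then show ?thesis
    using that e re m me by blast
qed

end


section \<open>Reflexive relations in protomodular categories\<close>

locale pointed_protomodular_category = pointed_category + protomodular_category
begin

text \<open>Protomodularity is applied to the arrow from the zero object to \<open>B\<close>. As
  \<open>k\<close> and \<open>f \<cdot> k\<close> share their domain \<open>N\<close>, the arrow
  induced by \<open>f\<close> on kernels is the identity of \<open>N\<close>.\<close>

lemma iso_on_kernel_imp_iso: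
  assumes p: "point B (A, p, s)" and p': "point B (A', p', s')"
    and f: "point_arrow (A, p, s) (A', p', s') f"
    and k: "is_kernel p k" and k': "is_kernel p' (f \<cdot> k)"
  shows "isomorphism f"
proof -
  have ph: "p \<in> hom C A B" and ph': "p' \<in> hom C A' B" and fh: "f \<in> hom C A A'"
    using p p' f unfolding point_def point_arrow_def by auto
  obtain N where kh: "k \<in> hom C N A"
    using kernel_hom[OF k ph] by blast
  have fk: "f \<cdot> k \<in> hom C N A'"
    using comp_hom[OF kh fh] .
  obtain Z where Z: "zero_object Z"
    using zero_ex by blast
  obtain t where t: "t \<in> hom C N Z"
    using to_zero[OF Z] hom_obs[OF kh] by blast
  obtain z where z: "z \<in> hom C Z B"
    using from_zero[OF Z] hom_obs[OF ph] by blast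
  have id: "Idn C N \<in> hom C N N"
    using idn_hom hom_obs[OF kh] by blast
  have "isomorphism (Idn C N)"
    unfolding isomorphism_def using id comp_idn[OF id] by (auto simp: hom_def)
  then show ?thesis
    using change_of_base_reflects_isos[OF z p p' f kernel_is_pullback[OF k ph kh Z z t]
        kernel_is_pullback[OF k' ph' fk Z z t], of "Idn C N"] id
      comp_idn[OF t] comp_idn[OF fk] hom_dom[OF t] by simp
qed

text \<open>Let \<open>W\<close> consist of the triples \<open>(x, y, z)\<close> with \<open>x R y\<close> and \<open>x R z\<close>, and let \<open>T\<close> be the
  part of it where also \<open>y R z\<close>. Over \<open>(x, y)\<close>, the inclusion \<open>T \<rightarrow> W\<close> is an arrow of points with
  section \<open>(x, y) \<mapsto> (x, y, y)\<close>, and is an isomorphism on kernels: a triple \<open>(0, 0, z)\<close> with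
  \<open>0 R z\<close> lies in \<open>T\<close>. By protomodularity, \<open>T = W\<close>.\<close>

lemma reflexive_relation_euclidean:
  assumes a1: "a1 \<in> hom C A G" and a2: "a2 \<in> hom C A G"
    and jm: "\<And>Y u v. u \<in> hom C Y A \<Longrightarrow> v \<in> hom C Y A \<Longrightarrow> a1 \<cdot> u = a1 \<cdot> v \<Longrightarrow>
      a2 \<cdot> u = a2 \<cdot> v \<Longrightarrow> u = v"
    and d: "d \<in> hom C G A" and a1d: "a1 \<cdot> d = Idn C G" and a2d: "a2 \<cdot> d = Idn C G"
    and u: "u \<in> hom C Y A" and v: "v \<in> hom C Y A" and uv: "a1 \<cdot> u = a1 \<cdot> v"
  obtains w where "w \<in> hom C Y A" "a1 \<cdot> w = a2 \<cdot> u" "a2 \<cdot> w = a2 \<cdot> v"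
proof -
  obtain W p q where pb: "is_pullback a1 a1 p q" and p: "p \<in> hom C W A" and q: "q \<in> hom C W A"
    and pq: "a1 \<cdot> p = a1 \<cdot> q"
    using pullback_ex[OF finite_limits a1 a1] by metis
  obtain Z where Z: "zero_object Z"
    using zero_ex by blast
  have G: "G \<in> Ob C"
    using hom_obs[OF a1] by blast
  obtain P \<pi>1 \<pi>2 where \<pi>1: "\<pi>1 \<in> hom C P G" and \<pi>2: "\<pi>2 \<in> hom C P G"
    and prod: "\<forall>X. \<forall>u \<in> hom C X G. \<forall>v \<in> hom C X G.
      \<exists>!w. w \<in> hom C X P \<and> \<pi>1 \<cdot> w = u \<and> \<pi>2 \<cdot> w = v"
    by (rule product_ex[OF finite_limits Z G G]) (rule that)
  have pair: "\<exists>w \<in> hom C X P. \<pi>1 \<cdot> w = x \<and> \<pi>2 \<cdot> w = y"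
    if "x \<in> hom C X G" "y \<in> hom C X G" for X x y
    using prod that by blast
  have jm\<pi>: "x = y"
    if "x \<in> hom C X P" "y \<in> hom C X P" "\<pi>1 \<cdot> x = \<pi>1 \<cdot> y" "\<pi>2 \<cdot> x = \<pi>2 \<cdot> y" for X x y
  proof -
    have "\<exists>!w. w \<in> hom C X P \<and> \<pi>1 \<cdot> w = \<pi>1 \<cdot> x \<and> \<pi>2 \<cdot> w = \<pi>2 \<cdot> x"
      using prod comp_hom[OF that(1) \<pi>1] comp_hom[OF that(1) \<pi>2] by blast
    then show ?thesis
      using that by metis
  qed
  \<comment> \<open>\<open>\<alpha>\<close> is the relation inside the product \<open>P\<close> of
    \<open>G\<close> with itself, and \<open>\<beta>\<close> sends a triple (x, y, z) to (y, z).
    Their pullback \<open>T\<close> pairs a triple with a witness \<open>l\<close> of y R z.\<close>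
  obtain \<alpha> where \<alpha>: "\<alpha> \<in> hom C A P" "\<pi>1 \<cdot> \<alpha> = a1" "\<pi>2 \<cdot> \<alpha> = a2"
    using pair[OF a1 a2] by blast
  have a2p: "a2 \<cdot> p \<in> hom C W G" and a2q: "a2 \<cdot> q \<in> hom C W G"
    using comp_hom a2 p q by blast+
  obtain \<beta> where \<beta>: "\<beta> \<in> hom C W P" "\<pi>1 \<cdot> \<beta> = a2 \<cdot> p" "\<pi>2 \<cdot> \<beta> = a2 \<cdot> q"
    using pair[OF a2p a2q] by blast
  obtain T n l where pbT: "is_pullback \<beta> \<alpha> n l" and n: "n \<in> hom C T W" and l: "l \<in> hom C T A"
    and nl: "\<beta> \<cdot> n = \<alpha> \<cdot> l"
    using pullback_ex[OF finite_limits \<beta>(1) \<alpha>(1)] by metis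
  have "a1 \<cdot> l = \<pi>1 \<cdot> (\<beta> \<cdot> n)" "a2 \<cdot> l = \<pi>2 \<cdot> (\<beta> \<cdot> n)"
    unfolding nl using comp_eq_comp[OF \<alpha>(2) \<alpha>(1) \<pi>1 l] comp_eq_comp[OF \<alpha>(3) \<alpha>(1) \<pi>2 l]
    by simp_all
  then have a1l: "a1 \<cdot> l = a2 \<cdot> (p \<cdot> n)" and a2l: "a2 \<cdot> l = a2 \<cdot> (q \<cdot> n)"
    using comp_eq_comp[OF \<beta>(2) \<beta>(1) \<pi>1 n] comp_eq_comp[OF \<beta>(3) \<beta>(1) \<pi>2 n]
      comp_assoc[OF n p a2] comp_assoc[OF n q a2] by simp_all
  \<comment> \<open>The witness \<open>l\<close> is determined by the triple, because the relation
    is jointly monic.\<close>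
  have mn: "monic n"
  proof (rule monicI[OF n])
    fix X x y
    assume x: "x \<in> hom C X T" and y: "y \<in> hom C X T" and xy: "n \<cdot> x = n \<cdot> y"
    have nx: "a1 \<cdot> (l \<cdot> x) = a2 \<cdot> (p \<cdot> (n \<cdot> x))" "a2 \<cdot> (l \<cdot> x) = a2 \<cdot> (q \<cdot> (n \<cdot> x))"
      if "x \<in> hom C X T" for x
      using comp_eq_comp[OF a1l l a1 that] comp_eq_comp[OF a2l l a2 that] a1 a2 p q n that
      by (simp_all add: arrow_simps)
    have "l \<cdot> x = l \<cdot> y"
      using jm[OF comp_hom[OF x l] comp_hom[OF y l]] nx[OF x] nx[OF y] xy by simp
    then show "x = y"
      using pullback_jointly_monic[OF pbT n x y xy] by blast
  qed
  \<comment> \<open>To lift a triple \<open>x\<close> to \<open>T\<close>, it suffices to give a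
    witness \<open>c\<close> that its second and third entries are related.\<close>
  have liftT: "\<exists>t \<in> hom C X T. n \<cdot> t = x"
    if x: "x \<in> hom C X W" and c: "c \<in> hom C X A"
      and eq: "a1 \<cdot> c = a2 \<cdot> (p \<cdot> x)" "a2 \<cdot> c = a2 \<cdot> (q \<cdot> x)" for X x c
  proof -
    have "\<pi>1 \<cdot> (\<beta> \<cdot> x) = \<pi>1 \<cdot> (\<alpha> \<cdot> c)" "\<pi>2 \<cdot> (\<beta> \<cdot> x) = \<pi>2 \<cdot> (\<alpha> \<cdot> c)"
      using comp_eq_comp[OF \<beta>(2) \<beta>(1) \<pi>1 x] comp_eq_comp[OF \<beta>(3) \<beta>(1) \<pi>2 x]
        comp_eq_comp[OF \<alpha>(2) \<alpha>(1) \<pi>1 c] comp_eq_comp[OF \<alpha>(3) \<alpha>(1) \<pi>2 c]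
        comp_assoc[OF x p a2] comp_assoc[OF x q a2] eq by simp_all
    then have "\<beta> \<cdot> x = \<alpha> \<cdot> c"
      using jm\<pi> comp_hom[OF x \<beta>(1)] comp_hom[OF c \<alpha>(1)] by blast
    then obtain t where "t \<in> hom C X T" "n \<cdot> t = x"
      using pullback_factor[OF pbT \<beta>(1) \<alpha>(1) n x c] by blast
    then show ?thesis
      by blast
  qed
  have idA: "Idn C A \<in> hom C A A"
    using idn_hom hom_obs[OF a1] by blast
  obtain \<sigma> where \<sigma>: "\<sigma> \<in> hom C A W" "p \<cdot> \<sigma> = Idn C A" "q \<cdot> \<sigma> = Idn C A"
    using pullback_factor[OF pb a1 a1 p idA idA] by blast
  \<comment> \<open>For the section (x, y, y) the witness is y R y, supplied by reflexivity.\<close>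
  have da2: "d \<cdot> a2 \<in> hom C A A"
    using comp_hom[OF a2 d] .
  have "a1 \<cdot> (d \<cdot> a2) = a2" "a2 \<cdot> (d \<cdot> a2) = a2"
    using comp_eq_comp[OF a1d d a1 a2] comp_eq_comp[OF a2d d a2 a2] idn_comp[OF a2] by simp_all
  then obtain \<sigma>' where \<sigma>': "\<sigma>' \<in> hom C A T" "n \<cdot> \<sigma>' = \<sigma>"
    using liftT[OF \<sigma>(1) da2] \<sigma> comp_idn[OF a2] by auto
  obtain \<kappa> where \<kappa>: "is_kernel p \<kappa>"
    using kernel_ex[OF finite_limits p] .
  obtain N where \<kappa>h: "\<kappa> \<in> hom C N W" and p\<kappa>: "p \<cdot> \<kappa> = zero_arrow N A"
    using kernel_hom[OF \<kappa> p] .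
  \<comment> \<open>On the kernel x = y = 0, so the witness \<open>q \<cdot> \<kappa>\<close> of x R
    z also serves for y R z.\<close>
  have "a1 \<cdot> (q \<cdot> \<kappa>) = a1 \<cdot> (p \<cdot> \<kappa>)"
    using comp_assoc[OF \<kappa>h p a1] comp_assoc[OF \<kappa>h q a1] pq by simp
  also have "\<dots> = a2 \<cdot> (p \<cdot> \<kappa>)"
    using p\<kappa> comp_zero_arrow[OF _ a1] comp_zero_arrow[OF _ a2] hom_obs[OF \<kappa>h] by simp
  finally obtain \<kappa>' where \<kappa>': "\<kappa>' \<in> hom C N T" "n \<cdot> \<kappa>' = \<kappa>"
    using liftT[OF \<kappa>h comp_hom[OF \<kappa>h q]] by blast
  have pn: "p \<cdot> n \<in> hom C T A"
    using comp_hom[OF n p] .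
  have "is_kernel (p \<cdot> n) \<kappa>'"
  proof (rule is_kernelI[OF pn \<kappa>'(1)])
    show "(p \<cdot> n) \<cdot> \<kappa>' = zero_arrow N A"
      using comp_assoc[OF \<kappa>'(1) n p] \<kappa>'(2) p\<kappa> by simp
    show "monic \<kappa>'"
    proof (rule monicI[OF \<kappa>'(1)])
      fix X x y
      assume x: "x \<in> hom C X N" and y: "y \<in> hom C X N" and xy: "\<kappa>' \<cdot> x = \<kappa>' \<cdot> y"
      then have "\<kappa> \<cdot> x = \<kappa> \<cdot> y"
        using comp_eq_comp[OF \<kappa>'(2) \<kappa>'(1) n x] comp_eq_comp[OF \<kappa>'(2) \<kappa>'(1) n y] by simp
      then show "x = y"
        using monicD[OF kernel_monic[OF \<kappa>] \<kappa>h x y] by blast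
    qed
    fix X x
    assume x: "x \<in> hom C X T" and "(p \<cdot> n) \<cdot> x = zero_arrow X A"
    then have "p \<cdot> (n \<cdot> x) = zero_arrow X A"
      using comp_assoc[OF x n p] by simp
    then obtain y where y: "y \<in> hom C X N" "\<kappa> \<cdot> y = n \<cdot> x"
      using kernel_factor[OF \<kappa> p \<kappa>h comp_hom[OF x n]] by blast
    then have "n \<cdot> (\<kappa>' \<cdot> y) = n \<cdot> x"
      using comp_eq_comp[OF \<kappa>'(2) \<kappa>'(1) n y(1)] by simp
    then have "\<kappa>' \<cdot> y = x"
      using monicD[OF mn n comp_hom[OF y(1) \<kappa>'(1)] x] by blast
    then show "\<exists>y. y \<in> hom C X N \<and> \<kappa>' \<cdot> y = x"
      using y by blast
  qed
  moreover have "point A (T, p \<cdot> n, \<sigma>')" "point A (W, p, \<sigma>)"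
    "point_arrow (T, p \<cdot> n, \<sigma>') (W, p, \<sigma>) n"
    unfolding point_def point_arrow_def
    using pn p n \<sigma> \<sigma>' comp_assoc[OF \<sigma>'(1) n p] by simp_all
  ultimately have "isomorphism n"
    using iso_on_kernel_imp_iso \<kappa> \<kappa>'(2) by blast
  then obtain \<nu> where \<nu>: "\<nu> \<in> hom C W T" "n \<cdot> \<nu> = Idn C W"
    unfolding isomorphism_def using n by (auto simp: hom_dom hom_cod)
  \<comment> \<open>\<open>u\<close> and \<open>v\<close> together form an element of
    \<open>W\<close>; the inverse \<open>\<nu>\<close> moves it into \<open>T\<close>, where
    \<open>l\<close> yields the required witness.\<close>
  obtain x where x: "x \<in> hom C Y W" "p \<cdot> x = u" "q \<cdot> x = v"
    using pullback_factor[OF pb a1 a1 p u v uv] .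
  have \<nu>x: "\<nu> \<cdot> x \<in> hom C Y T" and nx: "n \<cdot> (\<nu> \<cdot> x) = x"
    using comp_hom[OF x(1) \<nu>(1)] comp_eq_comp[OF \<nu>(2) \<nu>(1) n x(1)] idn_comp[OF x(1)] by simp_all
  have pnx: "(p \<cdot> n) \<cdot> (\<nu> \<cdot> x) = u" and qnx: "(q \<cdot> n) \<cdot> (\<nu> \<cdot> x) = v"
    using comp_assoc[OF \<nu>x n p] comp_assoc[OF \<nu>x n q] nx x by simp_all
  have "a1 \<cdot> (l \<cdot> (\<nu> \<cdot> x)) = a2 \<cdot> u" "a2 \<cdot> (l \<cdot> (\<nu> \<cdot> x)) = a2 \<cdot> v"
    using comp_eq_comp[OF a1l l a1 \<nu>x] comp_eq_comp[OF a2l l a2 \<nu>x]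
      comp_assoc[OF \<nu>x pn a2] comp_assoc[OF \<nu>x comp_hom[OF n q] a2] pnx qnx by simp_all
  then show ?thesis
    using that[OF comp_hom[OF \<nu>x l]] by blast
qed

text \<open>A reflexive relation that is Euclidean is symmetric and transitive.\<close>

lemma reflexive_relation_equivalence:
  assumes a1: "a1 \<in> hom C A G" and a2: "a2 \<in> hom C A G"
    and jm: "\<And>Y u v. u \<in> hom C Y A \<Longrightarrow> v \<in> hom C Y A \<Longrightarrow> a1 \<cdot> u = a1 \<cdot> v \<Longrightarrow>
      a2 \<cdot> u = a2 \<cdot> v \<Longrightarrow> u = v"
    and d: "d \<in> hom C G A" and a1d: "a1 \<cdot> d = Idn C G" and a2d: "a2 \<cdot> d = Idn C G"
  shows "equivalence_relation a1 a2"
proof -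
  have euclid: "\<exists>w \<in> hom C Y A. a1 \<cdot> w = a2 \<cdot> u \<and> a2 \<cdot> w = a2 \<cdot> v"
    if "u \<in> hom C Y A" "v \<in> hom C Y A" "a1 \<cdot> u = a1 \<cdot> v" for Y u v
    by (rule reflexive_relation_euclidean[OF a1 a2 _ d a1d a2d that]) (use jm in blast)+
  have id: "Idn C A \<in> hom C A A"
    using idn_hom hom_obs[OF a1] by blast
  have da1: "d \<cdot> a1 \<in> hom C A A"
    using comp_hom[OF a1 d] .
  have da1_eq: "a1 \<cdot> (d \<cdot> a1) = a1" "a2 \<cdot> (d \<cdot> a1) = a1"
    using comp_eq_comp[OF a1d d a1 a1] comp_eq_comp[OF a2d d a2 a1] idn_comp[OF a1] by simp_all
  \<comment> \<open>Symmetry: from \<open>x R y\<close> and \<open>x R x\<close> conclude \<open>y R x\<close>; transitivity then follows.\<close>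
  obtain s where s: "s \<in> hom C A A" "a1 \<cdot> s = a2" "a2 \<cdot> s = a1"
    using euclid[OF id da1] da1_eq comp_idn[OF a1] comp_idn[OF a2] by auto
  have "\<exists>t \<in> hom C (Dom C p) A. a1 \<cdot> t = a1 \<cdot> p \<and> a2 \<cdot> t = a2 \<cdot> q"
    if pb: "is_pullback a2 a1 p q" for p q
  proof -
    obtain P where p: "p \<in> hom C P A" and q: "q \<in> hom C P A" and pq: "a2 \<cdot> p = a1 \<cdot> q"
      using pullback_homs[OF pb a2 a1] .
    \<comment> \<open>Read \<open>p\<close> as x R y and \<open>q\<close> as y R z. Then
      \<open>s \<cdot> p\<close> is y R x, and the Euclidean property gives x R z.\<close>
    have "a1 \<cdot> (s \<cdot> p) = a1 \<cdot> q" "a2 \<cdot> (s \<cdot> p) = a1 \<cdot> p"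
      using comp_eq_comp[OF s(2,1) a1 p] comp_eq_comp[OF s(3,1) a2 p] pq by simp_all
    then show ?thesis
      using euclid[OF comp_hom[OF p s(1)] q] hom_dom[OF p] by metis
  qed
  then show ?thesis
    unfolding equivalence_relation_def using a1 a2 jm d a1d a2d s by blast
qed

end


section \<open>Coproducts and actions\<close>

context semi_abelian_category
begin

sublocale pointed_protomodular_category ..

section \<open>Binary coproducts and copairing\<close>

lemma coproduct_inl_inr:
  assumes "A \<in> Ob C" "B \<in> Ob C"
  shows "is_coproduct A B (inl A B) (inr A B)"
proof -
  have "\<exists>ij. (case ij of (i, j) \<Rightarrow> is_coproduct A B i j)"
    using coproduct_ex[OF assms] by simp
  then have "case coprod_inj A B of (i, j) \<Rightarrow> is_coproduct A B i j"
    unfolding coprod_inj_def by (rule someI_ex)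
  then show ?thesis
    unfolding inl_def inr_def by (simp add: case_prod_beta)
qed

lemma
  assumes "A \<in> Ob C" "B \<in> Ob C"
  shows inl_hom: "inl A B \<in> hom C A (coprod A B)"
    and inr_hom: "inr A B \<in> hom C B (coprod A B)"
  using coproduct_inl_inr[OF assms] unfolding is_coproduct_def coprod_def by simp_all

lemma coprod_universal:
  assumes "u \<in> hom C A X" "v \<in> hom C B X"
  shows "\<exists>!w. w \<in> hom C (coprod A B) X \<and> w \<cdot> inl A B = u \<and> w \<cdot> inr A B = v"
  using coproduct_inl_inr[of A B] assms hom_obs[OF assms(1)] hom_obs[OF assms(2)]
  unfolding is_coproduct_def coprod_def by blast

lemma
  assumes "u \<in> hom C A X" "v \<in> hom C B X"
  shows copair_hom: "copair u v \<in> hom C (coprod A B) X"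
    and copair_inl: "copair u v \<cdot> inl A B = u"
    and copair_inr: "copair u v \<cdot> inr A B = v"
proof -
  have d: "Dom C u = A" "Dom C v = B" "Cod C u = X"
    using assms by (auto simp: hom_def)
  show "copair u v \<in> hom C (coprod A B) X" "copair u v \<cdot> inl A B = u" "copair u v \<cdot> inr A B = v"
    using theI'[OF coprod_universal[OF assms]] unfolding copair_def d by simp_all
qed

lemma coprod_eqI:
  assumes "A \<in> Ob C" "B \<in> Ob C" "w \<in> hom C (coprod A B) X" "w' \<in> hom C (coprod A B) X"
    and "w \<cdot> inl A B = w' \<cdot> inl A B" "w \<cdot> inr A B = w' \<cdot> inr A B"
  shows "w = w'"
  using coprod_universal[OF comp_hom[OF inl_hom[OF assms(1,2)] assms(4)]
      comp_hom[OF inr_hom[OF assms(1,2)] assms(4)]] assms by metis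

lemma comp_copair:
  assumes u: "u \<in> hom C A X" and v: "v \<in> hom C B X" and f: "f \<in> hom C X Y"
  shows "f \<cdot> copair u v = copair (f \<cdot> u) (f \<cdot> v)"
proof -
  have ob: "A \<in> Ob C" "B \<in> Ob C"
    using hom_obs u v by blast+
  have fu: "f \<cdot> u \<in> hom C A Y" and fv: "f \<cdot> v \<in> hom C B Y"
    using comp_hom u v f by blast+
  show ?thesis
    by (rule coprod_eqI[OF ob comp_hom[OF copair_hom[OF u v] f] copair_hom[OF fu fv]])
      (simp_all add: comp_assoc[OF inl_hom[OF ob] copair_hom[OF u v] f]
        comp_assoc[OF inr_hom[OF ob] copair_hom[OF u v] f]
        copair_inl[OF u v] copair_inr[OF u v] copair_inl[OF fu fv] copair_inr[OF fu fv])
qed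

section \<open>Chosen kernels and the functor from points to kernels\<close>

lemma is_kernel_ker:
  assumes "f \<in> hom C A B"
  shows "is_kernel f (ker f)"
proof -
  obtain k where "is_kernel f k"
    using kernel_ex[OF finite_limits assms] .
  then show ?thesis
    unfolding ker_def by (rule someI)
qed

lemma ker_hom:
  assumes "f \<in> hom C A B"
  shows "ker f \<in> hom C (Dom C (ker f)) A"
  using is_kernel_ker[OF assms] assms unfolding is_kernel_def by (simp add: hom_dom)

lemma
  assumes p: "p \<in> hom C A B" and p': "p' \<in> hom C A' B" and f: "f \<in> hom C A A'"
    and p'f: "p' \<cdot> f = p"
  shows Ker_ar_hom: "Ker_ar (A, p, s) (A', p', s') f \<in> hom C (Dom C (ker p)) (Dom C (ker p'))"
    and ker_Ker_ar: "ker p' \<cdot> Ker_ar (A, p, s) (A', p', s') f = f \<cdot> ker p"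
proof -
  note k = ker_hom[OF p] and k' = ker_hom[OF p']
  have "p' \<cdot> (f \<cdot> ker p) = zero_arrow (Dom C (ker p)) B"
    using comp_eq_comp[OF p'f f p' k] kernel_zero[OF is_kernel_ker[OF p] p k] by simp
  then obtain u where "u \<in> hom C (Dom C (ker p)) (Dom C (ker p')) \<and> ker p' \<cdot> u = f \<cdot> ker p"
    using kernel_factor[OF is_kernel_ker[OF p'] p' k' comp_hom[OF k f]] by blast
  then have "\<exists>!u. u \<in> hom C (Dom C (ker p)) (Dom C (ker p')) \<and> ker p' \<cdot> u = f \<cdot> ker p"
    using monicD[OF kernel_monic[OF is_kernel_ker[OF p']] k'] by metis
  from theI'[OF this]
  show "Ker_ar (A, p, s) (A', p', s') f \<in> hom C (Dom C (ker p)) (Dom C (ker p'))"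
    "ker p' \<cdot> Ker_ar (A, p, s) (A', p', s') f = f \<cdot> ker p"
    unfolding Ker_ar_def by simp_all
qed

section \<open>The monad \<open>flat B\<close>\<close>

abbreviation
  "free_proj B X \<equiv> copair (Idn C B) (zero_arrow X B)"

abbreviation
  "flat_incl B X \<equiv> ker (free_proj B X)"

lemma
  assumes "B \<in> Ob C" "X \<in> Ob C"
  shows free_proj_hom: "free_proj B X \<in> hom C (coprod B X) B"
    and free_proj_inl: "free_proj B X \<cdot> inl B X = Idn C B"
    and free_proj_inr: "free_proj B X \<cdot> inr B X = zero_arrow X B"
proof -
  note * = idn_hom[OF assms(1)] zero_arrow_hom[OF assms(2,1)]
  show "free_proj B X \<in> hom C (coprod B X) B" "free_proj B X \<cdot> inl B X = Idn C B"
    "free_proj B X \<cdot> inr B X = zero_arrow X B"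
    using copair_hom[OF *] copair_inl[OF *] copair_inr[OF *] .
qed

lemma flat_incl_hom:
  assumes "B \<in> Ob C" "X \<in> Ob C"
  shows "flat_incl B X \<in> hom C (flat B X) (coprod B X)"
  using ker_hom[OF free_proj_hom[OF assms]] by (simp add: flat_def Ker_ob_def free_point_def)

lemma flat_incl_kernel:
  assumes "B \<in> Ob C" "X \<in> Ob C"
  shows "is_kernel (free_proj B X) (flat_incl B X)"
  using is_kernel_ker[OF free_proj_hom[OF assms]] .

lemma flat_ob: "B \<in> Ob C \<Longrightarrow> X \<in> Ob C \<Longrightarrow> flat B X \<in> Ob C"
  using flat_incl_hom hom_obs by blast

lemma free_proj_flat_incl:
  assumes "B \<in> Ob C" "X \<in> Ob C"
  shows "free_proj B X \<cdot> flat_incl B X = zero_arrow (flat B X) B"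
  using kernel_zero[OF flat_incl_kernel free_proj_hom flat_incl_hom] assms by simp

text \<open>\<open>flat_incl B X\<close> is monic, so an arrow into \<open>flat B X\<close> is
  determined by its composite with it. Unit, effect on arrows and multiplication of the monad are
  all handled through such composites.\<close>

lemma
  assumes "B \<in> Ob C" "X \<in> Ob C"
  shows flat_unit_hom: "flat_unit B X \<in> hom C X (flat B X)"
    and flat_incl_unit: "flat_incl B X \<cdot> flat_unit B X = inr B X"
proof -
  note k = flat_incl_hom[OF assms]
  obtain u where "u \<in> hom C X (flat B X)" "flat_incl B X \<cdot> u = inr B X"
    using kernel_factor[OF flat_incl_kernel[OF assms] free_proj_hom[OF assms] k inr_hom[OF assms]
        free_proj_inr[OF assms]] .
  then have "\<exists>!u. u \<in> hom C X (flat B X) \<and> flat_incl B X \<cdot> u = inr B X"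
    using monicD[OF kernel_monic[OF flat_incl_kernel[OF assms]] k] by metis
  from theI'[OF this]
  show "flat_unit B X \<in> hom C X (flat B X)" "flat_incl B X \<cdot> flat_unit B X = inr B X"
    unfolding flat_unit_def by simp_all
qed

lemma
  assumes B: "B \<in> Ob C" and f: "f \<in> hom C X Y"
  shows flat_ar_hom: "flat_ar B f \<in> hom C (flat B X) (flat B Y)"
    and flat_incl_ar: "flat_incl B Y \<cdot> flat_ar B f =
      copair (inl B Y) (inr B Y \<cdot> f) \<cdot> flat_incl B X"
proof -
  have X: "X \<in> Ob C" and Y: "Y \<in> Ob C"
    using hom_obs f by blast+
  note i = inl_hom[OF B Y] and j = comp_hom[OF f inr_hom[OF B Y]]
  have "free_proj B Y \<cdot> copair (inl B Y) (inr B Y \<cdot> f) = free_proj B X"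
    using comp_copair[OF i j free_proj_hom[OF B Y]] free_proj_inl[OF B Y]
      comp_eq_comp[OF free_proj_inr[OF B Y] inr_hom[OF B Y] free_proj_hom[OF B Y] f]
      zero_arrow_comp[OF B f] by simp
  note * = free_proj_hom[OF B X] free_proj_hom[OF B Y] copair_hom[OF i j] this
  show "flat_ar B f \<in> hom C (flat B X) (flat B Y)"
    "flat_incl B Y \<cdot> flat_ar B f = copair (inl B Y) (inr B Y \<cdot> f) \<cdot> flat_incl B X"
    using Ker_ar_hom[OF *] ker_Ker_ar[OF *] f
    by (simp_all add: flat_ar_def flat_def Ker_ob_def free_point_def free_point_ar_def hom_def)
qed

lemma
  assumes B: "B \<in> Ob C" and X: "X \<in> Ob C"
  shows flat_mult_hom: "flat_mult B X \<in> hom C (flat B (flat B X)) (flat B X)"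
    and flat_incl_mult: "flat_incl B X \<cdot> flat_mult B X =
      copair (inl B X) (flat_incl B X) \<cdot> flat_incl B (flat B X)"
proof -
  note F = flat_ob[OF B X] and i = inl_hom[OF B X] and j = flat_incl_hom[OF B X]
  have "free_proj B X \<cdot> copair (inl B X) (flat_incl B X) = free_proj B (flat B X)"
    using comp_copair[OF i j free_proj_hom[OF B X]] free_proj_inl[OF B X]
      free_proj_flat_incl[OF B X] by simp
  note * = free_proj_hom[OF B F] free_proj_hom[OF B X] copair_hom[OF i j] this
  show "flat_mult B X \<in> hom C (flat B (flat B X)) (flat B X)"
    "flat_incl B X \<cdot> flat_mult B X = copair (inl B X) (flat_incl B X) \<cdot> flat_incl B (flat B X)"
    using Ker_ar_hom[OF *] ker_Ker_ar[OF *] 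
    by (simp_all add: flat_mult_def flat_def Ker_ob_def free_point_def point_counit_def)
qed

text \<open>Serves twice: with \<open>f\<close> an action, for its associativity law, and with
  \<open>f\<close> the inclusion of a subobject, for restricting an action.\<close>

lemma copair_flat_ar:
  assumes B: "B \<in> Ob C" and f: "f \<in> hom C X Y" and s: "s \<in> hom C B A" and k: "k \<in> hom C Y A"
  shows "copair s k \<cdot> (flat_incl B Y \<cdot> flat_ar B f) = copair s (k \<cdot> f) \<cdot> flat_incl B X"
proof -
  have X: "X \<in> Ob C" and Y: "Y \<in> Ob C"
    using hom_obs f by blast+
  note i = inl_hom[OF B Y] and j = comp_hom[OF f inr_hom[OF B Y]] and sk = copair_hom[OF s k]
  have "copair s k \<cdot> copair (inl B Y) (inr B Y \<cdot> f) = copair s (k \<cdot> f)"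
    using comp_copair[OF i j sk] copair_inl[OF s k]
      comp_eq_comp[OF copair_inr[OF s k] inr_hom[OF B Y] sk f] by simp
  then show ?thesis
    unfolding flat_incl_ar[OF B f]
    using comp_eq_comp[OF _ copair_hom[OF i j] sk flat_incl_hom[OF B X]] by simp
qed

text \<open>This is the algebra structure carried by the kernel of a point. The two laws are checked
  after composing with \<open>k\<close>, which is monic.\<close>

lemma point_action:
  assumes p: "p \<in> hom C A B" and s: "s \<in> hom C B A" and ps: "p \<cdot> s = Idn C B"
    and ker: "is_kernel p k" and k: "k \<in> hom C X A"
  obtains \<xi> where "action B X \<xi>" "k \<cdot> \<xi> = copair s k \<cdot> flat_incl B X"
proof -
  have B: "B \<in> Ob C" and X: "X \<in> Ob C"
    using hom_obs p k by blast+
  note F = flat_ob[OF B X] and i = flat_incl_hom[OF B X] and sk = copair_hom[OF s k]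
  have pk: "p \<cdot> k = zero_arrow X B"
    using kernel_zero[OF ker p k] .
  \<comment> \<open>\<open>copair s k\<close> is the counit at the point, with \<open>k\<close> as
    its kernel. It lies over \<open>B\<close>, hence restricts to the kernels; the restriction is
    \<open>\<xi>\<close>.\<close>
  have "p \<cdot> copair s k = free_proj B X"
    using comp_copair[OF s k p] ps pk by simp
  then have "p \<cdot> (copair s k \<cdot> flat_incl B X) = zero_arrow (flat B X) B"
    using comp_eq_comp[OF _ sk p i] free_proj_flat_incl[OF B X] by simp
  then obtain \<xi> where \<xi>: "\<xi> \<in> hom C (flat B X) X" and k\<xi>: "k \<cdot> \<xi> = copair s k \<cdot> flat_incl B X"
    using kernel_factor[OF ker p k comp_hom[OF i sk]] by blast
  note k_eq = monicD[OF kernel_monic[OF ker] k]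
  note \<eta> = flat_unit_hom[OF B X] and \<mu> = flat_mult_hom[OF B X] and \<xi>' = flat_ar_hom[OF B \<xi>]
  have "k \<cdot> (\<xi> \<cdot> flat_unit B X) = k \<cdot> Idn C X"
    using comp_eq_comp[OF k\<xi> \<xi> k \<eta>] comp_assoc[OF \<eta> i sk] flat_incl_unit[OF B X]
      copair_inr[OF s k] comp_idn[OF k] by simp
  then have unit: "\<xi> \<cdot> flat_unit B X = Idn C X"
    using k_eq[OF comp_hom[OF \<eta> \<xi>] idn_hom[OF X]] by blast
  note ii = inl_hom[OF B X] and iF = flat_incl_hom[OF B F]
  have "k \<cdot> (\<xi> \<cdot> flat_mult B X) = copair s k \<cdot> (flat_incl B X \<cdot> flat_mult B X)"
    using comp_eq_comp[OF k\<xi> \<xi> k \<mu>] comp_assoc[OF \<mu> i sk] by simp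
  also have "\<dots> = copair s (copair s k \<cdot> flat_incl B X) \<cdot> flat_incl B (flat B X)"
    unfolding flat_incl_mult[OF B X]
    using comp_assoc[OF iF copair_hom[OF ii i] sk] comp_copair[OF ii i sk] copair_inl[OF s k] by simp
  also have "\<dots> = copair s k \<cdot> (flat_incl B X \<cdot> flat_ar B \<xi>)"
    using copair_flat_ar[OF B \<xi> s k] k\<xi> by simp
  also have "\<dots> = k \<cdot> (\<xi> \<cdot> flat_ar B \<xi>)"
    using comp_eq_comp[OF k\<xi> \<xi> k \<xi>'] comp_assoc[OF \<xi>' i sk] by simp
  finally have "\<xi> \<cdot> flat_mult B X = \<xi> \<cdot> flat_ar B \<xi>"
    using k_eq[OF comp_hom[OF \<mu> \<xi>] comp_hom[OF \<xi>' \<xi>]] by blast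
  then show ?thesis
    using that[OF _ k\<xi>] unit B X \<xi> unfolding action_def by blast
qed

text \<open>Let \<open>N\<close> be the kernel of \<open>p \<cdot> m\<close>. Restricting
  \<open>e\<close> to kernels gives a regular epimorphism from \<open>flat B H\<close> onto
  \<open>N\<close>, and the equation for \<open>\<xi>\<close> makes its composite into
  \<open>A\<close> factor through \<open>c\<close>. Hence \<open>N\<close> lies in \<open>H\<close>;
  conversely \<open>e \<cdot> inr B H\<close> maps \<open>H\<close> into \<open>N\<close>.\<close>

lemma kernel_of_image:
  assumes p: "p \<in> hom C A B" and s: "s \<in> hom C B A" and ps: "p \<cdot> s = Idn C B"
    and c: "c \<in> hom C H A" and mc: "monic c" and pc: "p \<cdot> c = zero_arrow H B"
    and \<xi>: "\<xi> \<in> hom C (flat B H) H" and c\<xi>: "c \<cdot> \<xi> = copair s c \<cdot> flat_incl B H"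
    and e: "e \<in> hom C (coprod B H) I" and re: "regular_epi e"
    and m: "m \<in> hom C I A" and mm: "monic m" and me: "m \<cdot> e = copair s c"
  shows "is_kernel (p \<cdot> m) (e \<cdot> inr B H)"
proof -
  have B: "B \<in> Ob C" and H: "H \<in> Ob C"
    using hom_obs p c by blast+
  note i = flat_incl_hom[OF B H] and j = inr_hom[OF B H]
  have x: "p \<cdot> m \<in> hom C I B"
    using comp_hom[OF m p] .
  have xe: "(p \<cdot> m) \<cdot> e = free_proj B H"
    using comp_assoc[OF e m p] me comp_copair[OF s c p] ps pc by simp
  define \<kappa> where "\<kappa> = ker (p \<cdot> m)"
  have \<kappa>: "is_kernel (p \<cdot> m) \<kappa>"
    unfolding \<kappa>_def using is_kernel_ker[OF x] .
  obtain N where \<kappa>h: "\<kappa> \<in> hom C N I" and x\<kappa>: "(p \<cdot> m) \<cdot> \<kappa> = zero_arrow N B"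
    using kernel_hom[OF \<kappa> x] .
  have "(p \<cdot> m) \<cdot> (e \<cdot> flat_incl B H) = zero_arrow (flat B H) B"
    using comp_eq_comp[OF xe e x i] free_proj_flat_incl[OF B H] by simp
  then obtain e0 where e0: "e0 \<in> hom C (flat B H) N" and \<kappa>e0: "\<kappa> \<cdot> e0 = e \<cdot> flat_incl B H"
    using kernel_factor[OF \<kappa> x \<kappa>h comp_hom[OF i e]] by blast
  \<comment> \<open>Since \<open>(p \<cdot> m) \<cdot> e\<close> is \<open>free_proj B H\<close>,
    its kernel is the preimage of \<open>N\<close> under \<open>e\<close>. This makes
    \<open>e0\<close> a pullback of \<open>e\<close>.\<close>
  have "is_pullback \<kappa> e e0 (flat_incl B H)"
  proof (rule is_pullbackI[OF \<kappa>h e e0 i \<kappa>e0])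
    fix Y u v
    assume u: "u \<in> hom C Y N" and v: "v \<in> hom C Y (coprod B H)" and uv: "\<kappa> \<cdot> u = e \<cdot> v"
    have "free_proj B H \<cdot> v = (p \<cdot> m) \<cdot> (\<kappa> \<cdot> u)"
      using comp_eq_comp[OF xe e x v] uv by simp
    also have "\<dots> = zero_arrow Y B"
      using comp_eq_comp[OF x\<kappa> \<kappa>h x u] zero_arrow_comp[OF B u] by simp
    finally obtain y where y: "y \<in> hom C Y (flat B H)" "flat_incl B H \<cdot> y = v"
      using kernel_factor[OF flat_incl_kernel[OF B H] free_proj_hom[OF B H] i v] by blast
    have "\<kappa> \<cdot> (e0 \<cdot> y) = \<kappa> \<cdot> u"
      using comp_eq_comp[OF \<kappa>e0 e0 \<kappa>h y(1)] comp_assoc[OF y(1) i e] y(2) uv by simp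
    then have "e0 \<cdot> y = u"
      using monicD[OF kernel_monic[OF \<kappa>] \<kappa>h comp_hom[OF y(1) e0] u] by blast
    then show "\<exists>w. w \<in> hom C Y (flat B H) \<and> e0 \<cdot> w = u \<and> flat_incl B H \<cdot> w = v"
      using y by blast
  next
    fix Y u v
    assume "u \<in> hom C Y (flat B H)" "v \<in> hom C Y (flat B H)"
      "flat_incl B H \<cdot> u = flat_incl B H \<cdot> v"
    then show "u = v"
      using monicD[OF kernel_monic[OF flat_incl_kernel[OF B H]] i] by blast
  qed
  then have re0: "regular_epi e0"
    using regular_epi_stable[OF re] by blast
  have key: "m \<cdot> (\<kappa> \<cdot> e0) = c \<cdot> \<xi>"
    using \<kappa>e0 comp_eq_comp[OF me e m i] c\<xi> by simp
  have m\<kappa>: "m \<cdot> \<kappa> \<in> hom C N A"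
    using comp_hom[OF \<kappa>h m] .
  have mke0: "(m \<cdot> \<kappa>) \<cdot> e0 = c \<cdot> \<xi>"
    using key comp_assoc[OF e0 \<kappa>h m] by simp
  have "\<xi> \<cdot> a = \<xi> \<cdot> b"
    if a: "a \<in> hom C Y (flat B H)" and b: "b \<in> hom C Y (flat B H)" and ab: "e0 \<cdot> a = e0 \<cdot> b"
    for Y a b
  proof -
    have "c \<cdot> (\<xi> \<cdot> a) = c \<cdot> (\<xi> \<cdot> b)"
      using comp_assoc[OF a e0 m\<kappa>] comp_assoc[OF b e0 m\<kappa>] mke0 comp_assoc[OF a \<xi> c]
        comp_assoc[OF b \<xi> c] ab by simp
    then show ?thesis
      using monicD[OF mc c comp_hom[OF a \<xi>] comp_hom[OF b \<xi>]] by blast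
  qed
  \<comment> \<open>\<open>N\<close> is the image of \<open>c \<cdot> \<xi>\<close>; this arrow identifies it with \<open>H\<close>.\<close>
  then obtain \<phi> where \<phi>: "\<phi> \<in> hom C N H" and \<phi>e0: "\<phi> \<cdot> e0 = \<xi>"
    using regular_epi_factor[OF re0 e0 \<xi>] by blast
  have "(m \<cdot> \<kappa>) \<cdot> e0 = (c \<cdot> \<phi>) \<cdot> e0"
    using mke0 \<phi>e0 comp_assoc[OF e0 \<phi> c] by simp
  then have m\<kappa>_eq: "m \<cdot> \<kappa> = c \<cdot> \<phi>"
    using regular_epi_cancel[OF re0 e0 m\<kappa> comp_hom[OF \<phi> c]] by blast
  have ej: "e \<cdot> inr B H \<in> hom C H I"
    using comp_hom[OF j e] .
  have mej: "m \<cdot> (e \<cdot> inr B H) = c"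
    using comp_eq_comp[OF me e m j] copair_inr[OF s c] by simp
  show ?thesis
  proof (rule is_kernelI[OF x ej])
    show "(p \<cdot> m) \<cdot> (e \<cdot> inr B H) = zero_arrow H B"
      using comp_eq_comp[OF xe e x j] free_proj_inr[OF B H] by simp
    show "monic (e \<cdot> inr B H)"
    proof (rule monicI[OF ej])
      fix X u v
      assume u: "u \<in> hom C X H" and v: "v \<in> hom C X H"
        and uv: "(e \<cdot> inr B H) \<cdot> u = (e \<cdot> inr B H) \<cdot> v"
      have "c \<cdot> u = c \<cdot> v"
        using comp_eq_comp[OF mej ej m u] comp_eq_comp[OF mej ej m v] uv by simp
      then show "u = v"
        using monicD[OF mc c u v] by blast
    qed
    fix X u
    assume u: "u \<in> hom C X I" and "(p \<cdot> m) \<cdot> u = zero_arrow X B"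
    then obtain y where y: "y \<in> hom C X N" "\<kappa> \<cdot> y = u"
      using kernel_factor[OF \<kappa> x \<kappa>h u] by blast
    have \<phi>y: "\<phi> \<cdot> y \<in> hom C X H"
      using comp_hom[OF y(1) \<phi>] .
    \<comment> \<open>The factorisation of \<open>u\<close> through \<open>N\<close>, followed by
      \<open>\<phi>\<close>, is its factorisation through \<open>H\<close>; it is checked after
      composing with the monic \<open>m\<close>.\<close>
    have "m \<cdot> u = c \<cdot> (\<phi> \<cdot> y)"
      using y comp_eq_comp[OF m\<kappa>_eq \<kappa>h m y(1)] comp_assoc[OF y(1) \<phi> c] by simp
    also have "\<dots> = m \<cdot> ((e \<cdot> inr B H) \<cdot> (\<phi> \<cdot> y))"
      using comp_eq_comp[OF mej ej m \<phi>y] by simp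
    finally have "u = (e \<cdot> inr B H) \<cdot> (\<phi> \<cdot> y)"
      using monicD[OF mm m u comp_hom[OF \<phi>y ej]] by blast
    then show "\<exists>w. w \<in> hom C X H \<and> (e \<cdot> inr B H) \<cdot> w = u"
      using \<phi>y by blast
  qed
qed

text \<open>By exactness the relation is the kernel pair of some \<open>g\<close>. As
  \<open>c\<close> picks out the related pairs with first entry 0, \<open>a2 \<cdot> c\<close> is
  the class of 0, and that is the kernel of \<open>g\<close>.\<close>

lemma equivalence_relation_class_normal:
  assumes a1: "a1 \<in> hom C A G" and a2: "a2 \<in> hom C A G" and eq: "equivalence_relation a1 a2"
    and ker: "is_kernel a1 c" and c: "c \<in> hom C H A" and mono: "monic (a2 \<cdot> c)"
  shows "normal_subobject (a2 \<cdot> c)"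
proof -
  obtain g where kp: "is_pullback g g a1 a2"
    using effective[OF eq] unfolding is_kernel_pair_def by blast
  define Q where "Q = Cod C g"
  have g: "g \<in> hom C G Q" and ga: "g \<cdot> a1 = g \<cdot> a2"
    using kp a1 unfolding is_pullback_def Q_def by (auto simp: hom_def)
  have G: "G \<in> Ob C" and H: "H \<in> Ob C"
    using hom_obs a1 c by blast+
  have a1c: "a1 \<cdot> c = zero_arrow H G"
    using kernel_zero[OF ker a1 c] .
  have a2c: "a2 \<cdot> c \<in> hom C H G"
    using comp_hom[OF c a2] .
  have "is_kernel g (a2 \<cdot> c)"
  proof (rule is_kernelI[OF g a2c _ mono])
    show "g \<cdot> (a2 \<cdot> c) = zero_arrow H Q"
      using comp_assoc[OF c a1 g] comp_assoc[OF c a2 g] ga a1c comp_zero_arrow[OF H g] by simp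
    fix X u
    assume u: "u \<in> hom C X G" and "g \<cdot> u = zero_arrow X Q"
    \<comment> \<open>\<open>g\<close> identifies 0 and \<open>u\<close>, so the pair (0,
      \<open>u\<close>) belongs to the relation.\<close>
    then have "g \<cdot> zero_arrow X G = g \<cdot> u"
      using comp_zero_arrow[OF _ g] hom_obs[OF u] by simp
    then obtain w where w: "w \<in> hom C X A" "a1 \<cdot> w = zero_arrow X G" "a2 \<cdot> w = u"
      using pullback_factor[OF kp g g a1 zero_arrow_hom u] hom_obs[OF u] by blast
    obtain z where z: "z \<in> hom C X H" "c \<cdot> z = w"
      using kernel_factor[OF ker a1 c w(1,2)] .
    then have "(a2 \<cdot> c) \<cdot> z = u"
      using comp_assoc[OF z(1) c a2] w by simp
    then show "\<exists>w. w \<in> hom C X H \<and> (a2 \<cdot> c) \<cdot> w = u"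
      using z by blast
  qed
  then show ?thesis
    unfolding normal_subobject_def using mono by blast
qed

lemma characteristic_in_normal:
  assumes h: "h \<in> hom C H K" and mh: "monic h" and k: "k \<in> hom C K G" and mk: "monic k"
    and char: "characteristic_subobject h" and normal: "normal_subobject k"
  shows "normal_subobject (k \<cdot> h)"
proof -
  have G: "G \<in> Ob C" and K: "K \<in> Ob C" and H: "H \<in> Ob C"
    using hom_obs h k by blast+
  obtain f where fk: "is_kernel f k"
    using normal unfolding normal_subobject_def by blast
  define Q where "Q = Cod C f"
  have f: "f \<in> hom C G Q" and fk0: "f \<cdot> k = zero_arrow K Q"
    using fk k unfolding is_kernel_def Q_def by (auto simp: hom_def)
  obtain R r1 r2 where kp: "is_pullback f f r1 r2" and r1: "r1 \<in> hom C R G"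
    and r2: "r2 \<in> hom C R G" and fr: "f \<cdot> r1 = f \<cdot> r2"
    using pullback_ex[OF finite_limits f f] by metis
  \<comment> \<open>The diagonal \<open>s\<close> makes the kernel pair a point over
    \<open>G\<close> with projection \<open>r1\<close>.\<close>
  obtain s where s: "s \<in> hom C G R" "r1 \<cdot> s = Idn C G" "r2 \<cdot> s = Idn C G"
    using pullback_factor[OF kp f f r1 idn_hom[OF G] idn_hom[OF G]] by blast
  \<comment> \<open>\<open>k'\<close> is the pair (0, \<open>k\<close>), whose entries are both sent
    to 0 by \<open>f\<close>.\<close>
  have "f \<cdot> zero_arrow K G = f \<cdot> k"
    using comp_zero_arrow[OF K f] fk0 by simp
  then obtain k' where k': "k' \<in> hom C K R" and r1k': "r1 \<cdot> k' = zero_arrow K G"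
    and r2k': "r2 \<cdot> k' = k"
    using pullback_factor[OF kp f f r1 zero_arrow_hom[OF K G] k] by blast
  have mk': "monic k'"
  proof (rule monicI[OF k'])
    fix X u v
    assume u: "u \<in> hom C X K" and v: "v \<in> hom C X K" and uv: "k' \<cdot> u = k' \<cdot> v"
    then have "k \<cdot> u = k \<cdot> v"
      using comp_eq_comp[OF r2k' k' r2 u] comp_eq_comp[OF r2k' k' r2 v] by simp
    then show "u = v"
      using monicD[OF mk k u v] by blast
  qed
  \<comment> \<open>If (0, y) lies in \<open>R\<close>, then \<open>f\<close> sends y to 0, so y
    factors through \<open>k\<close>.\<close>
  have kerk': "is_kernel r1 k'"
  proof (rule is_kernelI[OF r1 k' r1k' mk'])
    fix X u
    assume u: "u \<in> hom C X R" and z: "r1 \<cdot> u = zero_arrow X G"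
    have X: "X \<in> Ob C"
      using hom_obs[OF u] by blast
    have "f \<cdot> (r2 \<cdot> u) = zero_arrow X Q"
      using comp_assoc[OF u r1 f] comp_assoc[OF u r2 f] fr z comp_zero_arrow[OF X f] by simp
    then obtain y where y: "y \<in> hom C X K" "k \<cdot> y = r2 \<cdot> u"
      using kernel_factor[OF fk f k comp_hom[OF u r2]] by blast
    have "r1 \<cdot> (k' \<cdot> y) = r1 \<cdot> u" "r2 \<cdot> (k' \<cdot> y) = r2 \<cdot> u"
      using comp_eq_comp[OF r1k' k' r1 y(1)] comp_eq_comp[OF r2k' k' r2 y(1)]
        zero_arrow_comp[OF G y(1)] z y(2) by simp_all
    then have "k' \<cdot> y = u"
      using pullback_jointly_monic[OF kp r1 comp_hom[OF y(1) k'] u] by blast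
    then show "\<exists>w. w \<in> hom C X K \<and> k' \<cdot> w = u"
      using y by blast
  qed
  obtain \<xi> where \<xi>: "action G K \<xi>" and k'\<xi>: "k' \<cdot> \<xi> = copair s k' \<cdot> flat_incl G K"
    using point_action[OF r1 s(1,2) kerk' k'] .
  have \<xi>h: "\<xi> \<in> hom C (flat G K) K"
    using \<xi> unfolding action_def by blast
  obtain \<xi>' where "action G H \<xi>'" and h\<xi>': "h \<cdot> \<xi>' = \<xi> \<cdot> flat_ar G h"
    using char \<xi> unfolding characteristic_subobject_def hom_dom[OF h] hom_cod[OF h] by blast
  then have \<xi>'h: "\<xi>' \<in> hom C (flat G H) H"
    unfolding action_def by blast
  define c where "c = k' \<cdot> h"
  have c: "c \<in> hom C H R"
    unfolding c_def using comp_hom[OF h k'] .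
  have mc: "monic c"
    unfolding c_def using monic_comp[OF mh h mk' k'] .
  have r1c: "r1 \<cdot> c = zero_arrow H G"
    unfolding c_def using comp_eq_comp[OF r1k' k' r1 h] zero_arrow_comp[OF G h] by simp
  note ha = flat_ar_hom[OF G h]
  \<comment> \<open>Conjugation by \<open>G\<close> keeps \<open>H\<close> inside itself: on
    \<open>flat G H\<close> the arrow \<open>copair s c\<close> factors through \<open>c\<close>.
    This is the equation that \<open>kernel_of_image\<close> asks for.\<close>
  have "c \<cdot> \<xi>' = (k' \<cdot> \<xi>) \<cdot> flat_ar G h"
    unfolding c_def using comp_assoc[OF \<xi>'h h k'] h\<xi>' comp_assoc[OF ha \<xi>h k'] by simp
  also have "\<dots> = copair s c \<cdot> flat_incl G H"
    unfolding c_def k'\<xi> using comp_assoc[OF ha flat_incl_hom[OF G K] copair_hom[OF s(1) k']]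
      copair_flat_ar[OF G h s(1) k'] by simp
  finally have c\<xi>': "c \<cdot> \<xi>' = copair s c \<cdot> flat_incl G H" .
  obtain A e m where e: "e \<in> hom C (coprod G H) A" and re: "regular_epi e"
    and m: "m \<in> hom C A R" and mm: "monic m" and me: "m \<cdot> e = copair s c"
    using image_factorisation[OF copair_hom[OF s(1) c]] .
  note i = inl_hom[OF G H] and j = inr_hom[OF G H]
  have a1: "r1 \<cdot> m \<in> hom C A G" and a2: "r2 \<cdot> m \<in> hom C A G"
    using comp_hom m r1 r2 by blast+
  have kern: "is_kernel (r1 \<cdot> m) (e \<cdot> inr G H)"
    using kernel_of_image[OF r1 s(1,2) c mc r1c \<xi>'h c\<xi>' e re m mm me] .
  \<comment> \<open>The image \<open>A\<close> contains the diagonal, by way of \<open>inl\<close>,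
    and the pairs (0, x) with x in \<open>H\<close>, by way of \<open>inr\<close>. The former makes
    it reflexive.\<close>
  have mei: "m \<cdot> (e \<cdot> inl G H) = s" and mej: "m \<cdot> (e \<cdot> inr G H) = c"
    using comp_eq_comp[OF me e m i] comp_eq_comp[OF me e m j]
      copair_inl[OF s(1) c] copair_inr[OF s(1) c] by simp_all
  have d: "e \<cdot> inl G H \<in> hom C G A" and ej: "e \<cdot> inr G H \<in> hom C H A"
    using comp_hom e i j by blast+
  have "equivalence_relation (r1 \<cdot> m) (r2 \<cdot> m)"
  proof (rule reflexive_relation_equivalence[OF a1 a2 _ d])
    fix Y u v
    assume u: "u \<in> hom C Y A" and v: "v \<in> hom C Y A"
      and "(r1 \<cdot> m) \<cdot> u = (r1 \<cdot> m) \<cdot> v" "(r2 \<cdot> m) \<cdot> u = (r2 \<cdot> m) \<cdot> v"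
    then have "r1 \<cdot> (m \<cdot> u) = r1 \<cdot> (m \<cdot> v)" "r2 \<cdot> (m \<cdot> u) = r2 \<cdot> (m \<cdot> v)"
      using comp_assoc[OF u m r1] comp_assoc[OF v m r1] comp_assoc[OF u m r2]
        comp_assoc[OF v m r2] by simp_all
    then have "m \<cdot> u = m \<cdot> v"
      using pullback_jointly_monic[OF kp r1 comp_hom[OF u m] comp_hom[OF v m]] by blast
    then show "u = v"
      using monicD[OF mm m u v] by blast
  next
    show "(r1 \<cdot> m) \<cdot> (e \<cdot> inl G H) = Idn C G" "(r2 \<cdot> m) \<cdot> (e \<cdot> inl G H) = Idn C G"
      using comp_assoc[OF d m r1] comp_assoc[OF d m r2] mei s by simp_all
  qed
  moreover have "(r2 \<cdot> m) \<cdot> (e \<cdot> inr G H) = k \<cdot> h"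
    using comp_assoc[OF ej m r2] mej comp_eq_comp[OF r2k' k' r2 h] unfolding c_def by simp
  ultimately show ?thesis
    using equivalence_relation_class_normal[OF a1 a2 _ kern ej] monic_comp[OF mh h mk k] by simp
qed

end


theorem proposition2p4:
  fixes C :: "('o, 'a) cat" (structure)
    and H K G :: 'o and h k :: 'a
  assumes "semi_abelian_category C"
    and "h \<in> hom C H K" and "category.monic C h"
    and "k \<in> hom C K G" and "category.monic C k"
    and "category.characteristic_subobject C h"
    and "category.normal_subobject C k"
  shows "category.normal_subobject C (k \<cdot> h)"
proof -
  interpret semi_abelian_category C
    by fact
  show ?thesis
    using characteristic_in_normal assms(2-7) .
qed

end
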